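(* Let $(M,J)$ be an almost complex manifold. For every $k$ there is a natural well-defined map $$H^k_{d+d^c}\longrightarrow H^k_{ev}+H^k_{od},\qquad[\alpha]_{d+d^c}\longmapsto[\alpha^{ev}]_d+[\alpha^{od}]_d.$$
   Context: An almost complex manifold $(M,J)$ is a smooth $2m$-manifold with a smooth $(1,1)$-tensor field $J$, $J^2=-\mathrm{Id}$. $A^k$ is the space of smooth complex $k$-forms, with bigrading $A^k=\bigoplus_{p+q=k}A^{p,q}$ induced by $J$. $J$ acts on forms by duality, as an algebra automorphism: $J\alpha=i^{p-q}\alpha$ for $\alpha\in A^{p,q}$. Set $d^c:=J^{-1}dJ$. Let $B^\bullet:=\{\alpha\in A^\bullet:(dd^c+d^cd)\alpha=0\}$, which is preserved by $d$ and $d^c$. The Bott-Chern cohomology is $$H^k_{d+d^c}:=\frac{\ker(d\colon B^k\to B^{k+1})\cap\ker(d^c\colon B^k\to B^{k+1})}{\operatorname{Im}(dd^c\colon B^{k-2}\to B^k)}.$$ Let $A^k_{ev}:=\bigoplus_{p+q=k,\ p\text{ even}}A^{p,q}$ and $A^k_{od}:=\bigoplus_{p+q=k,\ p\text{ odd}}A^{p,q}$, so $A^k=A^k_{ev}\oplus A^k_{od}$; write $\alpha=\alpha^{ev}+\alpha^{od}$ for the corresponding decomposition. $H^k_{ev}$ (resp. $H^k_{od}$) is the subspace of complex de Rham cohomology $H^k_d$ consisting of the classes admitting a $d$-closed representative in $A^k_{ev}$ (resp. $A^k_{od}$). $[\cdot]_d$ denotes a de Rham class. *)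

theory Defs
  imports
    "HOL-Analysis.Analysis"
    "HOL-Combinatorics.Permutations"
    "HOL-Library.Function_Algebras"
    "HOL-Library.Set_Algebras"
begin

section \<open>Smooth maps on open subsets of a finite-dimensional space\<close>

text \<open>Meant for open \<^term>\<open>S\<close> and a finite-dimensional domain: a map is of class \<open>C^(n+1)\<close> iff it is
  differentiable and all its directional derivatives are of class \<open>C^n\<close>.\<close>

primrec Cn_on :: "nat \<Rightarrow> 'e::real_inner set \<Rightarrow> ('e \<Rightarrow> 'f::real_normed_vector) \<Rightarrow> bool" where
  "Cn_on 0 S f \<longleftrightarrow> continuous_on S f"
| "Cn_on (Suc n) S f \<longleftrightarrow>
     (\<forall>x\<in>S. f differentiable (at x)) \<and> (\<forall>v. Cn_on n S (\<lambda>x. frechet_derivative f (at x) v))"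

definition smooth_on :: "'e::real_inner set \<Rightarrow> ('e \<Rightarrow> 'f::real_normed_vector) \<Rightarrow> bool" where
  "smooth_on S f \<longleftrightarrow> (\<forall>n. Cn_on n S f)"

section \<open>Almost complex manifolds\<close>

text \<open>The model space is a real inner product space of finite dimension; the class
  \<^class>\<open>euclidean_space\<close> is not used because it excludes dimension \<open>0\<close>.  The dimension is stated by
  exhibiting a basis because \<^const>\<open>dim\<close> is also \<open>0\<close> on infinite-dimensional spaces.\<close>

definition has_dimension :: "'e::real_inner itself \<Rightarrow> nat \<Rightarrow> bool" where
  "has_dimension _ n \<longleftrightarrow>
     (\<exists>B::'e set. finite B \<and> independent B \<and> span B = UNIV \<and> card B = n)"

type_synonym ('a, 'e) chart = "'a set \<times> ('a \<Rightarrow> 'e)"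

definition chart_image :: "('a, 'e) chart \<Rightarrow> 'e set" where
  "chart_image c = snd c ` fst c"

definition is_chart :: "'a topology \<Rightarrow> ('a, 'e::real_inner) chart \<Rightarrow> bool" where
  "is_chart X c \<longleftrightarrow>
     openin X (fst c) \<and> open (chart_image c) \<and>
     homeomorphic_map (subtopology X (fst c)) (top_of_set (chart_image c)) (snd c)"

definition transition :: "('a, 'e) chart \<Rightarrow> ('a, 'e) chart \<Rightarrow> 'e \<Rightarrow> 'e" where
  "transition c c' = snd c' \<circ> inv_into (fst c) (snd c)"

definition smooth_manifold ::
    "nat \<Rightarrow> 'a topology \<Rightarrow> ('a, 'e::real_inner) chart set \<Rightarrow> bool" where
  "smooth_manifold n X A \<longleftrightarrow>
     has_dimension TYPE('e) n \<and> Hausdorff_space X \<and> second_countable X \<and>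
     (\<forall>c\<in>A. is_chart X c) \<and> \<Union>(fst ` A) = topspace X \<and>
     (\<forall>c\<in>A. \<forall>c'\<in>A. smooth_on (snd c ` (fst c \<inter> fst c')) (transition c c'))"

text \<open>The differential at the point \<^term>\<open>p\<close> of the change of coordinates, which identifies the
  coordinate expressions of a tangent vector at \<^term>\<open>p\<close> in two charts.\<close>

definition dtransition :: "('a, 'e::real_inner) chart \<Rightarrow> ('a, 'e) chart \<Rightarrow> 'a \<Rightarrow> 'e \<Rightarrow> 'e" where
  "dtransition c c' p = frechet_derivative (transition c c') (at (snd c p))"

text \<open>Tensor fields are given by their coordinate expressions in the charts of the atlas, related
  by the transformation law on overlaps.  A \<open>(1,1)\<close>-tensor field has in each chart \<^term>\<open>c\<close> the
  expression \<^term>\<open>J c x\<close>, an endomorphism of the model space depending smoothly on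
  \<^term>\<open>x \<in> chart_image c\<close>.\<close>

type_synonym ('a, 'e) endo_field = "('a, 'e) chart \<Rightarrow> 'e \<Rightarrow> 'e \<Rightarrow> 'e"

definition smooth_endo_field ::
    "('a, 'e::real_inner) chart set \<Rightarrow> ('a, 'e) endo_field \<Rightarrow> bool" where
  "smooth_endo_field A J \<longleftrightarrow>
     (\<forall>c\<in>A. \<forall>x\<in>chart_image c. linear (J c x)) \<and>
     (\<forall>c\<in>A. \<forall>v. smooth_on (chart_image c) (\<lambda>x. J c x v)) \<and>
     (\<forall>c\<in>A. \<forall>c'\<in>A. \<forall>p\<in>fst c \<inter> fst c'. \<forall>v.
        dtransition c c' p (J c (snd c p) v) = J c' (snd c' p) (dtransition c c' p v))"

definition almost_complex_manifold ::
    "nat \<Rightarrow> 'a topology \<Rightarrow> ('a, 'e::real_inner) chart set \<Rightarrow> ('a, 'e) endo_field \<Rightarrow> bool" where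
  "almost_complex_manifold m X A J \<longleftrightarrow>
     smooth_manifold (2 * m) X A \<and> smooth_endo_field A J \<and>
     (\<forall>c\<in>A. \<forall>x\<in>chart_image c. \<forall>v. J c x (J c x v) = - v)"

section \<open>Complex differential forms\<close>

text \<open>Alternating \<open>\<real>\<close>-multilinear maps of \<^term>\<open>k\<close> arguments; the arguments are the entries
  \<open>v 0, \<dots>, v (k - 1)\<close> of a sequence \<^term>\<open>v\<close>, the others being irrelevant.\<close>

definition alternating_map :: "nat \<Rightarrow> ((nat \<Rightarrow> 'e::real_vector) \<Rightarrow> complex) \<Rightarrow> bool" where
  "alternating_map k f \<longleftrightarrow>
     (\<forall>v w. (\<forall>i<k. v i = w i) \<longrightarrow> f v = f w) \<and>
     (\<forall>i<k. \<forall>v. linear (\<lambda>u. f (v(i := u)))) \<and>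
     (\<forall>v. \<forall>i<k. \<forall>j<k. i \<noteq> j \<and> v i = v j \<longrightarrow> f v = 0)"

type_synonym ('a, 'e) form = "('a, 'e) chart \<Rightarrow> 'e \<Rightarrow> (nat \<Rightarrow> 'e) \<Rightarrow> complex"

text \<open>The space \<open>A^k\<close>.  The last condition selects a unique representative by fixing the value \<open>0\<close>
  where the coordinate expression has no meaning.\<close>

definition forms :: "('a, 'e::real_inner) chart set \<Rightarrow> nat \<Rightarrow> ('a, 'e) form set" where
  "forms A k = {\<alpha>.
     (\<forall>c\<in>A. \<forall>x\<in>chart_image c. alternating_map k (\<alpha> c x)) \<and>
     (\<forall>c\<in>A. \<forall>v. smooth_on (chart_image c) (\<lambda>x. \<alpha> c x v)) \<and>
     (\<forall>c\<in>A. \<forall>c'\<in>A. \<forall>p\<in>fst c \<inter> fst c'. \<forall>v.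
        \<alpha> c (snd c p) v = \<alpha> c' (snd c' p) (\<lambda>i. dtransition c c' p (v i))) \<and>
     (\<forall>c x. \<not> (c \<in> A \<and> x \<in> chart_image c) \<longrightarrow> \<alpha> c x = 0)}"

definition scale_form :: "complex \<Rightarrow> ('a, 'e) form \<Rightarrow> ('a, 'e) form" where
  "scale_form z \<alpha> = (\<lambda>c x v. z * \<alpha> c x v)"

definition omit :: "nat \<Rightarrow> (nat \<Rightarrow> 'e) \<Rightarrow> nat \<Rightarrow> 'e" where
  "omit i v = (\<lambda>j. if j < i then v j else v (Suc j))"

text \<open>The exterior derivative of a \<^term>\<open>k\<close>-form,
  \<open>(d\<alpha>)(v_0, \<dots>, v_k) = \<Sum>i. (-1)^i (D\<^sub>v\<^sub>i \<alpha>)(v_0, \<dots>, omit v_i, \<dots>, v_k)\<close> for constant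
  vectors \<open>v_i\<close> in a chart.\<close>

definition ext_d :: "('a, 'e::real_inner) chart set \<Rightarrow> nat \<Rightarrow> ('a, 'e) form \<Rightarrow> ('a, 'e) form" where
  "ext_d A k \<alpha> = (\<lambda>c x v. if c \<in> A \<and> x \<in> chart_image c
     then \<Sum>i\<le>k. (- 1) ^ i * frechet_derivative (\<lambda>y. \<alpha> c y (omit i v)) (at x) (v i)
     else 0)"

section \<open>Bidegree and the operator \<open>d^c\<close>\<close>

text \<open>Exterior product \<open>\<theta>_0 \<and> \<dots> \<and> \<theta>_(k-1)\<close> of complex covectors.\<close>

definition wedge :: "nat \<Rightarrow> (nat \<Rightarrow> 'e \<Rightarrow> complex) \<Rightarrow> (nat \<Rightarrow> 'e) \<Rightarrow> complex" where
  "wedge k \<theta> v =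
     (\<Sum>\<sigma> | \<sigma> permutes {..<k}. of_int (sign \<sigma>) * (\<Prod>j<k. \<theta> j (v (\<sigma> j))))"

definition covectors_10 :: "('e::real_vector \<Rightarrow> 'e) \<Rightarrow> ('e \<Rightarrow> complex) set" where
  "covectors_10 I = {\<theta>. linear \<theta> \<and> (\<forall>v. \<theta> (I v) = \<i> * \<theta> v)}"

definition covectors_01 :: "('e::real_vector \<Rightarrow> 'e) \<Rightarrow> ('e \<Rightarrow> complex) set" where
  "covectors_01 I = {\<theta>. linear \<theta> \<and> (\<forall>v. \<theta> (I v) = - \<i> * \<theta> v)}"

text \<open>The complex span of the products of \<^term>\<open>p\<close> covectors of type \<open>(1,0)\<close> and \<^term>\<open>q\<close> covectors
  of type \<open>(0,1)\<close> with respect to a linear complex structure \<^term>\<open>I\<close>.\<close>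

definition pq_covectors ::
    "nat \<Rightarrow> nat \<Rightarrow> ('e::real_vector \<Rightarrow> 'e) \<Rightarrow> ((nat \<Rightarrow> 'e) \<Rightarrow> complex) set" where
  "pq_covectors p q I =
     {(\<lambda>v. \<Sum>n<N. z n * wedge (p + q) (\<theta> n) v) | (N::nat) (z :: nat \<Rightarrow> complex) \<theta>.
        \<forall>n<N. (\<forall>j<p. \<theta> n j \<in> covectors_10 I) \<and> (\<forall>j\<in>{p..<p + q}. \<theta> n j \<in> covectors_01 I)}"

definition pq_forms ::
    "('a, 'e::real_inner) chart set \<Rightarrow> ('a, 'e) endo_field \<Rightarrow> nat \<Rightarrow> nat \<Rightarrow> ('a, 'e) form set" where
  "pq_forms A J p q =
     {\<alpha> \<in> forms A (p + q). \<forall>c\<in>A. \<forall>x\<in>chart_image c. \<alpha> c x \<in> pq_covectors p q (J c x)}"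

text \<open>With \<^term>\<open>even\<close> or \<^term>\<open>odd\<close> for \<^term>\<open>P\<close>: the spaces \<open>A^k_ev\<close> and \<open>A^k_od\<close>, i.e. the sum of
  the \<open>A^(p,k-p)\<close> with \<^term>\<open>P p\<close>.\<close>

definition sum_pq_forms ::
    "('a, 'e::real_inner) chart set \<Rightarrow> ('a, 'e) endo_field \<Rightarrow> (nat \<Rightarrow> bool) \<Rightarrow> nat
      \<Rightarrow> ('a, 'e) form set" where
  "sum_pq_forms A J P k =
     {\<Sum>p | p \<le> k \<and> P p. \<beta> p | \<beta>. \<forall>p\<le>k. P p \<longrightarrow> \<beta> p \<in> pq_forms A J p (k - p)}"

abbreviation "ev_forms A J \<equiv> sum_pq_forms A J even"
abbreviation "od_forms A J \<equiv> sum_pq_forms A J odd"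

definition ev_part ::
    "('a, 'e::real_inner) chart set \<Rightarrow> ('a, 'e) endo_field \<Rightarrow> nat \<Rightarrow> ('a, 'e) form \<Rightarrow> ('a, 'e) form"
  where "ev_part A J k \<alpha> = (THE \<beta>. \<beta> \<in> ev_forms A J k \<and> (\<exists>\<gamma>\<in>od_forms A J k. \<alpha> = \<beta> + \<gamma>))"

definition od_part ::
    "('a, 'e::real_inner) chart set \<Rightarrow> ('a, 'e) endo_field \<Rightarrow> nat \<Rightarrow> ('a, 'e) form \<Rightarrow> ('a, 'e) form"
  where "od_part A J k \<alpha> = (THE \<gamma>. \<gamma> \<in> od_forms A J k \<and> (\<exists>\<beta>\<in>ev_forms A J k. \<alpha> = \<beta> + \<gamma>))"

text \<open>The action \<open>(J\<alpha>)(v_1, \<dots>, v_k) = \<alpha>(J v_1, \<dots>, J v_k)\<close>; it is multiplication by \<open>i^(p-q)\<close> on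
  \<open>A^(p,q)\<close>.\<close>

definition J_form :: "('a, 'e) endo_field \<Rightarrow> ('a, 'e) form \<Rightarrow> ('a, 'e) form" where
  "J_form J \<alpha> = (\<lambda>c x v. \<alpha> c x (\<lambda>i. J c x (v i)))"

definition ext_dc ::
    "('a, 'e::real_inner) chart set \<Rightarrow> ('a, 'e) endo_field \<Rightarrow> nat \<Rightarrow> ('a, 'e) form \<Rightarrow> ('a, 'e) form"
  where "ext_dc A J k \<alpha> = inv_into (forms A (Suc k)) (J_form J) (ext_d A k (J_form J \<alpha>))"

section \<open>Cohomology\<close>

text \<open>The elements of a quotient by a subspace \<^term>\<open>S\<close> are the cosets \<^term>\<open>\<alpha> +o S\<close>, with the
  elementwise sum of sets as addition.  The summand \<^term>\<open>S\<close> in the scalar multiplication matters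
  only for the scalar \<open>0\<close>.\<close>

definition scale_coset ::
    "('a, 'e) form set \<Rightarrow> complex \<Rightarrow> ('a, 'e) form set \<Rightarrow> ('a, 'e) form set" where
  "scale_coset S z C = scale_form z ` C + S"

definition B_forms ::
    "('a, 'e::real_inner) chart set \<Rightarrow> ('a, 'e) endo_field \<Rightarrow> nat \<Rightarrow> ('a, 'e) form set" where
  "B_forms A J k = {\<alpha> \<in> forms A k.
     ext_d A (Suc k) (ext_dc A J k \<alpha>) + ext_dc A J (Suc k) (ext_d A k \<alpha>) = 0}"

definition BC_closed ::
    "('a, 'e::real_inner) chart set \<Rightarrow> ('a, 'e) endo_field \<Rightarrow> nat \<Rightarrow> ('a, 'e) form set" where
  "BC_closed A J k = {\<alpha> \<in> B_forms A J k. ext_d A k \<alpha> = 0 \<and> ext_dc A J k \<alpha> = 0}"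

definition BC_exact ::
    "('a, 'e::real_inner) chart set \<Rightarrow> ('a, 'e) endo_field \<Rightarrow> nat \<Rightarrow> ('a, 'e) form set" where
  "BC_exact A J k = (if k < 2 then {0}
     else (\<lambda>\<beta>. ext_d A (k - 1) (ext_dc A J (k - 2) \<beta>)) ` B_forms A J (k - 2))"

definition BC_class ::
    "('a, 'e::real_inner) chart set \<Rightarrow> ('a, 'e) endo_field \<Rightarrow> nat \<Rightarrow> ('a, 'e) form \<Rightarrow> ('a, 'e) form set"
  where "BC_class A J k \<alpha> = \<alpha> +o BC_exact A J k"

definition BC_cohomology ::
    "('a, 'e::real_inner) chart set \<Rightarrow> ('a, 'e) endo_field \<Rightarrow> nat \<Rightarrow> ('a, 'e) form set set" where
  "BC_cohomology A J k = BC_class A J k ` BC_closed A J k"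

definition dR_closed :: "('a, 'e::real_inner) chart set \<Rightarrow> nat \<Rightarrow> ('a, 'e) form set" where
  "dR_closed A k = {\<alpha> \<in> forms A k. ext_d A k \<alpha> = 0}"

definition dR_exact :: "('a, 'e::real_inner) chart set \<Rightarrow> nat \<Rightarrow> ('a, 'e) form set" where
  "dR_exact A k = (if k = 0 then {0} else ext_d A (k - 1) ` forms A (k - 1))"

definition dR_class ::
    "('a, 'e::real_inner) chart set \<Rightarrow> nat \<Rightarrow> ('a, 'e) form \<Rightarrow> ('a, 'e) form set" where
  "dR_class A k \<alpha> = \<alpha> +o dR_exact A k"

definition dR_cohomology ::
    "('a, 'e::real_inner) chart set \<Rightarrow> nat \<Rightarrow> ('a, 'e) form set set" where
  "dR_cohomology A k = dR_class A k ` dR_closed A k"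

definition H_ev ::
    "('a, 'e::real_inner) chart set \<Rightarrow> ('a, 'e) endo_field \<Rightarrow> nat \<Rightarrow> ('a, 'e) form set set" where
  "H_ev A J k = {C \<in> dR_cohomology A k. \<exists>\<alpha>\<in>dR_closed A k \<inter> ev_forms A J k. C = dR_class A k \<alpha>}"

definition H_od ::
    "('a, 'e::real_inner) chart set \<Rightarrow> ('a, 'e) endo_field \<Rightarrow> nat \<Rightarrow> ('a, 'e) form set set" where
  "H_od A J k = {C \<in> dR_cohomology A k. \<exists>\<alpha>\<in>dR_closed A k \<inter> od_forms A J k. C = dR_class A k \<alpha>}"

end

theory Submission
  imports Defs
begin

text \<open>
  On \<open>A^(p,q)\<close> with \<open>p + q = k\<close> the operator \<open>J\<close> is multiplication by \<open>(-1)^p i^(-k)\<close>, so that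
  \<open>\<alpha>^ev\<close> and \<open>\<alpha>^od\<close> are \<open>(\<alpha> \<plusminus> i^k J \<alpha>) / 2\<close>.  If \<open>d \<alpha> = 0\<close> and \<open>d^c \<alpha> = J^(-1) d J \<alpha> = 0\<close>, both
  parts are therefore closed.  The sum of their classes is the de Rham class of \<open>\<alpha>\<close>, and \<open>dd^c\<close>-exact
  forms are \<open>d\<close>-exact; hence the map sends the coset \<open>C\<close> of \<open>Im dd^c\<close> to \<open>C + Im d\<close>.

  The analytic part is that \<open>d\<close> and \<open>J\<close> map forms to forms (for \<open>d\<close> this is the chain rule
  together with the symmetry of second derivatives), and that the \<open>(p,q)\<close>-components of a form are smooth.
\<close>

section \<open>Calculus of smooth maps\<close>

text \<open>\<open>ev_part\<close> and \<open>od_part\<close> are definite descriptions and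
  \<open>ext_dc\<close> is an \<open>inv_into\<close>, so every computation with them first needs
  existence. For \<open>ext_dc\<close> this is why d and J must be shown to preserve the spaces of
  forms, transformation law included. For the parts, the formula (\<alpha> \<plusminus> i^k
  J\<alpha>)/2 gives uniqueness and closedness, but not membership: \<open>sum_pq_forms\<close> asks
  for components that are themselves smooth forms, whereas \<open>pq_covectors\<close> describes a
  type at one point, through covectors chosen without regard to nearby points. The obstacle is to
  get the components without choosing a frame of (1,0)-covectors. They are Fourier coefficients of
  the circle action cos t + sin t J, that is, finite linear combinations of pull-backs of \<alpha>
  under smooth endomorphism fields; a frame is used only at single points, to identify the type.
  Where the arguments of a form vary with the point, constant orthogonal coordinates of the model
  space turn the expression into a finite sum of products.\<close>

lemma smooth_on_differentiable: "smooth_on S f \<Longrightarrow> x \<in> S \<Longrightarrow> f differentiable (at x)"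
  using Cn_on.simps(2)[of 0 S f] by (metis smooth_on_def)

lemma smooth_on_has_derivative:
  "smooth_on S f \<Longrightarrow> x \<in> S \<Longrightarrow> (f has_derivative frechet_derivative f (at x)) (at x)"
  using smooth_on_differentiable frechet_derivative_works by blast

lemma smooth_on_continuous: "smooth_on S f \<Longrightarrow> continuous_on S f"
  using Cn_on.simps(1)[of S f] by (metis smooth_on_def)

lemma smooth_on_frechet_derivative:
  assumes "smooth_on S f"
  shows "smooth_on S (\<lambda>x. frechet_derivative f (at x) v)"
  unfolding smooth_on_def
proof
  fix n
  have "Cn_on (Suc n) S f" using assms by (simp add: smooth_on_def)
  then show "Cn_on n S (\<lambda>x. frechet_derivative f (at x) v)" by simp
qed

lemma frechet_derivative_cong_open:
  assumes "open S" "x \<in> S" "\<And>y. y \<in> S \<Longrightarrow> f y = g y"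
  shows "frechet_derivative f (at x) = frechet_derivative g (at x)"
proof -
  have "(f has_derivative D) (at x) = (g has_derivative D) (at x)" for D
    using assms has_derivative_transform_within_open[of f D x UNIV S g]
      has_derivative_transform_within_open[of g D x UNIV S f] by auto
  then show ?thesis by (simp add: frechet_derivative_def)
qed

lemma differentiable_cong_open:
  assumes "open S" "x \<in> S" "\<And>y. y \<in> S \<Longrightarrow> f y = g y" "f differentiable (at x)"
  shows "g differentiable (at x)"
  using assms has_derivative_transform_within_open[of f _ x UNIV S g]
  unfolding differentiable_def by blast

text \<open>Openness of \<open>S\<close> makes equality on \<open>S\<close> an equality near each
  point, so it passes to the derivatives.\<close>

lemma Cn_on_cong:
  assumes "open S" "\<And>x. x \<in> S \<Longrightarrow> f x = g x" "Cn_on n S f"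
  shows "Cn_on n S g"
  using assms(2,3)
proof (induction n arbitrary: f g)
  case 0
  then show ?case by (simp cong: continuous_on_cong)
next
  case (Suc n)
  have "Cn_on n S (\<lambda>x. frechet_derivative g (at x) v)" for v
    using Suc.IH[of "\<lambda>x. frechet_derivative f (at x) v" "\<lambda>x. frechet_derivative g (at x) v"]
      Suc.prems frechet_derivative_cong_open[OF assms(1), of _ f g] by simp
  then show ?case
    using Suc.prems differentiable_cong_open[OF assms(1), of _ f g] by simp
qed

lemma smooth_on_cong:
  assumes "open S" "\<And>x. x \<in> S \<Longrightarrow> f x = g x" "smooth_on S f"
  shows "smooth_on S g"
  using assms Cn_on_cong unfolding smooth_on_def by blast

lemma smooth_on_subset:
  assumes "smooth_on S f" "T \<subseteq> S"
  shows "smooth_on T f"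
proof -
  have "Cn_on n S f \<Longrightarrow> Cn_on n T f" for n
  proof (induction n arbitrary: f)
    case 0
    then show ?case using assms(2) by (simp add: continuous_on_subset)
  qed (use assms(2) in auto)
  then show ?thesis using assms(1) by (simp add: smooth_on_def)
qed

lemma frechet_derivative_eqI: "(f has_derivative D) (at x) \<Longrightarrow> frechet_derivative f (at x) = D"
  by (rule frechet_derivative_at[symmetric])

section \<open>Closure properties of smooth maps\<close>

lemma Cn_on_const: "Cn_on n S (\<lambda>x. c)"
  by (induction n arbitrary: c) auto

lemma smooth_on_const: "smooth_on S (\<lambda>x. c)"
  by (simp add: smooth_on_def Cn_on_const)

lemma frechet_derivative_bounded_linear_compose:
  assumes "bounded_linear L" "f differentiable (at x)"
  shows "frechet_derivative (\<lambda>x. L (f x)) (at x) v = L (frechet_derivative f (at x) v)"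
  using frechet_derivative_eqI[OF bounded_linear.has_derivative[OF assms(1)
    assms(2)[unfolded frechet_derivative_works]]] by simp

lemma smooth_on_bounded_linear:
  assumes "open S" "bounded_linear L" "smooth_on S f"
  shows "smooth_on S (\<lambda>x. L (f x))"
proof -
  have "Cn_on n S f \<Longrightarrow> Cn_on n S (\<lambda>x. L (f x))" for n
  proof (induction n arbitrary: f)
    case 0
    then show ?case using assms(2) by (simp add: bounded_linear.continuous_on)
  next
    case (Suc n)
    have "Cn_on n S (\<lambda>x. frechet_derivative (\<lambda>x. L (f x)) (at x) v)" for v
      by (rule Cn_on_cong[OF assms(1) _ Suc.IH[of "\<lambda>x. frechet_derivative f (at x) v"]])
        (use Suc.prems assms(2) in \<open>simp_all add: frechet_derivative_bounded_linear_compose\<close>)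
    moreover have "(\<lambda>x. L (f x)) differentiable (at x)" if "x \<in> S" for x
      using bounded_linear.has_derivative[OF assms(2)] Suc.prems that
      unfolding differentiable_def Cn_on.simps by blast
    ultimately show ?case by simp
  qed
  then show ?thesis using assms(3) by (simp add: smooth_on_def)
qed

text \<open>Stated for each \<open>n\<close> because the product rule in
  \<open>smooth_on_mult\<close> needs sums at the level of its induction.\<close>

lemma Cn_on_add:
  assumes "open S"
  shows "Cn_on n S f \<Longrightarrow> Cn_on n S g \<Longrightarrow> Cn_on n S (\<lambda>x. f x + g x)"
proof (induction n arbitrary: f g)
  case 0
  then show ?case by (simp add: continuous_on_add)
next
  case (Suc n)
  have D: "((\<lambda>x. f x + g x) has_derivative
      (\<lambda>v. frechet_derivative f (at x) v + frechet_derivative g (at x) v)) (at x)" if "x \<in> S" for x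
    using Suc.prems that by (intro has_derivative_add) (simp_all add: frechet_derivative_works)
  have "Cn_on n S (\<lambda>x. frechet_derivative (\<lambda>x. f x + g x) (at x) v)" for v
    by (rule Cn_on_cong[OF assms _ Suc.IH[of "\<lambda>x. frechet_derivative f (at x) v"
          "\<lambda>x. frechet_derivative g (at x) v"]])
      (use Suc.prems in \<open>simp_all add: frechet_derivative_eqI[OF D]\<close>)
  then show ?case using D by (auto simp: differentiable_def)
qed

lemma smooth_on_add:
  "open S \<Longrightarrow> smooth_on S f \<Longrightarrow> smooth_on S g \<Longrightarrow> smooth_on S (\<lambda>x. f x + g x)"
  by (simp add: smooth_on_def Cn_on_add)

lemma smooth_on_sum:
  assumes "open S" "\<And>i. i \<in> I \<Longrightarrow> smooth_on S (f i)"
  shows "smooth_on S (\<lambda>x. \<Sum>i\<in>I. f i x)"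
  using assms(2)
  by (induction I rule: infinite_finite_induct)
     (auto simp: smooth_on_const intro!: smooth_on_add[OF assms(1)])

lemma smooth_on_mult:
  fixes f g :: "'e::real_inner \<Rightarrow> 'f::real_normed_algebra"
  assumes "open S" "smooth_on S f" "smooth_on S g"
  shows "smooth_on S (\<lambda>x. f x * g x)"
proof -
  \<comment> \<open>Both factors are assumed smooth rather than C^n: the terms of the product rule
    then have smooth factors again, and the induction hypothesis applies to each of them.\<close>
  have "Cn_on n S (\<lambda>x. f x * g x)" if "smooth_on S f" "smooth_on S g" for n f and g :: "'e \<Rightarrow> 'f"
    using that
  proof (induction n arbitrary: f g)
    case 0
    then show ?case by (simp add: continuous_on_mult smooth_on_continuous)
  next
    case (Suc n)
    have D: "((\<lambda>x. f x * g x) has_derivative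
        (\<lambda>v. f x * frechet_derivative g (at x) v + frechet_derivative f (at x) v * g x)) (at x)"
      if "x \<in> S" for x
      using Suc.prems that by (intro has_derivative_mult smooth_on_has_derivative)
    have "Cn_on n S (\<lambda>x. frechet_derivative (\<lambda>x. f x * g x) (at x) v)" for v
    proof (rule Cn_on_cong[OF assms(1)])
      show "Cn_on n S (\<lambda>x. f x * frechet_derivative g (at x) v + frechet_derivative f (at x) v * g x)"
        using Suc.prems by (intro Cn_on_add[OF assms(1)] Suc.IH smooth_on_frechet_derivative)
    qed (simp add: frechet_derivative_eqI[OF D])
    then show ?case using D by (auto simp: differentiable_def)
  qed
  then show ?thesis using assms(2,3) by (simp add: smooth_on_def)
qed

lemma smooth_on_prod:
  fixes f :: "'i \<Rightarrow> 'e::real_inner \<Rightarrow> 'f::{real_normed_algebra, comm_ring_1}"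
  assumes "open S" "\<And>i. i \<in> I \<Longrightarrow> smooth_on S (f i)"
  shows "smooth_on S (\<lambda>x. \<Prod>i\<in>I. f i x)"
  using assms(2)
  by (induction I rule: infinite_finite_induct)
     (auto simp: smooth_on_const intro!: smooth_on_mult[OF assms(1)])

section \<open>Symmetry of second derivatives\<close>

text \<open>The second difference on the left is visibly symmetric in \<open>h\<close> and
  \<open>w\<close>, the mixed derivative on the right is not; comparing the two readings will give
  the symmetry. The point \<open>p\<close> comes from the mean value theorem, applied in direction
  \<open>h\<close> and then in direction \<open>w\<close>.\<close>

lemma second_difference_mean_value:
  fixes g :: "'e::real_inner \<Rightarrow> real"
  assumes sm: "smooth_on (ball x r) g" and t: "0 < t" "t * (norm h + norm w) < r"
  shows "\<exists>p\<in>ball x r. g (x + t *\<^sub>R h + t *\<^sub>R w) - g (x + t *\<^sub>R h) - g (x + t *\<^sub>R w) + g x =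
    t\<^sup>2 * frechet_derivative (\<lambda>y. frechet_derivative g (at y) h) (at p) w"
proof -
  have mem: "x + a *\<^sub>R h + b *\<^sub>R w \<in> ball x r" if "0 \<le> a" "a \<le> t" "0 \<le> b" "b \<le> t" for a b
  proof -
    have "norm (a *\<^sub>R h + b *\<^sub>R w) \<le> a * norm h + b * norm w"
      using norm_triangle_ineq[of "a *\<^sub>R h" "b *\<^sub>R w"] that by simp
    also have "\<dots> \<le> t * norm h + t * norm w"
      using that by (intro add_mono mult_right_mono) auto
    finally have "norm (a *\<^sub>R h + b *\<^sub>R w) < r" using t by (simp add: distrib_left)
    moreover have "dist x (x + a *\<^sub>R h + b *\<^sub>R w) = norm (a *\<^sub>R h + b *\<^sub>R w)"
      by (simp add: dist_norm add.assoc norm_minus_commute flip: minus_add_distrib)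
    ultimately show ?thesis by simp
  qed
  \<comment> \<open>Chain rule along a line of constant velocity \<open>d\<close>, used for
    \<open>g\<close> in direction \<open>h\<close> and for its derivative in direction
    \<open>w\<close>.\<close>
  have line: "((\<lambda>s. f (q s)) has_real_derivative frechet_derivative f (at (q s)) d) (at s)"
    if "smooth_on (ball x r) f" "q s \<in> ball x r" "(q has_derivative (\<lambda>u. u *\<^sub>R d)) (at s)"
    for f :: "'e \<Rightarrow> real" and q s d
  proof -
    have "((\<lambda>s. f (q s)) has_derivative (\<lambda>u. frechet_derivative f (at (q s)) (u *\<^sub>R d))) (at s)"
      using diff_chain_at[OF that(3) smooth_on_has_derivative[OF that(1,2)]]
      by (simp add: o_def)
    moreover have "linear (frechet_derivative f (at (q s)))"
      using that by (meson has_derivative_linear smooth_on_has_derivative)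
    ultimately show ?thesis
      by (simp add: has_field_derivative_def linear_cmul mult.commute[of _ "frechet_derivative f (at (q s)) d"])
  qed
  let ?D = "\<lambda>y. frechet_derivative g (at y) h"
  have *: "((\<lambda>s. g (x + s *\<^sub>R h + b *\<^sub>R w)) has_real_derivative ?D (x + s *\<^sub>R h + b *\<^sub>R w)) (at s)"
    if "0 \<le> s" "s \<le> t" "0 \<le> b" "b \<le> t" for s b
    by (rule line[of g "\<lambda>s. x + s *\<^sub>R h + b *\<^sub>R w" s h, OF sm mem[OF that]])
       (auto intro!: derivative_eq_intros)
  \<comment> \<open>The terms with \<open>0 *\<^sub>R w\<close> keep both functions in the shape
    covered by \<open>*\<close>.\<close>
  have "\<exists>s>0. s < t \<and>
      (g (x + t *\<^sub>R h + t *\<^sub>R w) - g (x + t *\<^sub>R h + 0 *\<^sub>R w)) -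
        (g (x + 0 *\<^sub>R h + t *\<^sub>R w) - g (x + 0 *\<^sub>R h + 0 *\<^sub>R w)) =
      (t - 0) * (?D (x + s *\<^sub>R h + t *\<^sub>R w) - ?D (x + s *\<^sub>R h + 0 *\<^sub>R w))"
    by (rule MVT2[OF t(1), of "\<lambda>s. g (x + s *\<^sub>R h + t *\<^sub>R w) - g (x + s *\<^sub>R h + 0 *\<^sub>R w)"],
        rule DERIV_diff; rule *) (use t(1) in auto)
  then obtain s where s: "0 < s" "s < t"
    "(g (x + t *\<^sub>R h + t *\<^sub>R w) - g (x + t *\<^sub>R h + 0 *\<^sub>R w)) -
        (g (x + 0 *\<^sub>R h + t *\<^sub>R w) - g (x + 0 *\<^sub>R h + 0 *\<^sub>R w)) =
      (t - 0) * (?D (x + s *\<^sub>R h + t *\<^sub>R w) - ?D (x + s *\<^sub>R h + 0 *\<^sub>R w))"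
    by blast
  have **: "((\<lambda>b. ?D (x + s *\<^sub>R h + b *\<^sub>R w)) has_real_derivative
      frechet_derivative ?D (at (x + s *\<^sub>R h + b *\<^sub>R w)) w) (at b)" if "0 \<le> b" "b \<le> t" for b
    by (rule line[of ?D "\<lambda>b. x + s *\<^sub>R h + b *\<^sub>R w" b w, OF smooth_on_frechet_derivative[OF sm] mem])
       (use s that in \<open>auto intro!: derivative_eq_intros\<close>)
  have "\<exists>b>0. b < t \<and> ?D (x + s *\<^sub>R h + t *\<^sub>R w) - ?D (x + s *\<^sub>R h + 0 *\<^sub>R w) =
      (t - 0) * frechet_derivative ?D (at (x + s *\<^sub>R h + b *\<^sub>R w)) w"
    by (rule MVT2[OF t(1), of "\<lambda>b. ?D (x + s *\<^sub>R h + b *\<^sub>R w)"], rule **)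
  then obtain b where b: "0 < b" "b < t"
    "?D (x + s *\<^sub>R h + t *\<^sub>R w) - ?D (x + s *\<^sub>R h + 0 *\<^sub>R w) =
      (t - 0) * frechet_derivative ?D (at (x + s *\<^sub>R h + b *\<^sub>R w)) w"
    by blast
  have "x + s *\<^sub>R h + b *\<^sub>R w \<in> ball x r" using mem s b by simp
  moreover have "g (x + t *\<^sub>R h + t *\<^sub>R w) - g (x + t *\<^sub>R h) - g (x + t *\<^sub>R w) + g x =
    t\<^sup>2 * frechet_derivative ?D (at (x + s *\<^sub>R h + b *\<^sub>R w)) w"
    using s(3) unfolding b(3) by (simp add: power2_eq_square algebra_simps)
  ultimately show ?thesis by blast
qed

text \<open>If the mixed derivatives \<open>P\<close> and \<open>Q\<close> differed at
  \<open>x\<close>, each would stay, near \<open>x\<close>, within half of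
  \<open>\<bar>P x - Q x\<bar>\<close> of its value there; but the common second difference forces
  \<open>P p = Q q\<close> at two nearby points.\<close>

lemma second_derivative_symmetric_real:
  fixes g :: "'e::real_inner \<Rightarrow> real"
  assumes "open S" "x \<in> S" "smooth_on S g"
  shows "frechet_derivative (\<lambda>y. frechet_derivative g (at y) h) (at x) w =
    frechet_derivative (\<lambda>y. frechet_derivative g (at y) w) (at x) h"
proof (rule ccontr)
  define P where "P y = frechet_derivative (\<lambda>y. frechet_derivative g (at y) h) (at y) w" for y
  define Q where "Q y = frechet_derivative (\<lambda>y. frechet_derivative g (at y) w) (at y) h" for y
  assume "\<not> ?thesis"
  then have e: "0 < \<bar>P x - Q x\<bar> / 2" by (simp add: P_def Q_def)
  have "continuous_on S P" "continuous_on S Q"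
    unfolding P_def Q_def using assms(3) by (intro smooth_on_continuous smooth_on_frechet_derivative; assumption)+
  then have "isCont P x" "isCont Q x"
    using assms(1,2) by (simp_all add: continuous_on_eq_continuous_at)
  then obtain r1 r2 where r: "r1 > 0" "r2 > 0"
    "\<And>y. dist y x < r1 \<Longrightarrow> dist (P y) (P x) < \<bar>P x - Q x\<bar> / 2"
    "\<And>y. dist y x < r2 \<Longrightarrow> dist (Q y) (Q x) < \<bar>P x - Q x\<bar> / 2"
    using e unfolding continuous_at_eps_delta by blast
  obtain r3 where r3: "r3 > 0" "ball x r3 \<subseteq> S" using assms(1,2) open_contains_ball by blast
  define r where "r = min r1 (min r2 r3)"
  have r0: "r > 0" using r r3 by (simp add: r_def)
  have sm: "smooth_on (ball x r) g"
    by (rule smooth_on_subset[OF assms(3) subset_trans[OF _ r3(2)]]) (auto simp: r_def)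
  \<comment> \<open>The denominator exceeds \<open>norm h + norm w\<close> and is positive even if
    both vectors vanish.\<close>
  define t where "t = r / (2 * (norm h + norm w + 1))"
  have n: "norm h + norm w + 1 > 0" by (simp add: add_nonneg_pos)
  have t0: "t > 0" using r0 n by (simp add: t_def)
  have "norm h + norm w < 2 * (norm h + norm w + 1)"
    using norm_ge_zero[of h] norm_ge_zero[of w] by argo
  then have "t * (norm h + norm w) < t * (2 * (norm h + norm w + 1))"
    using t0 by (rule mult_strict_left_mono)
  also have "\<dots> = r" using n by (simp add: t_def)
  finally have t: "t * (norm h + norm w) < r" .
  obtain p where p: "p \<in> ball x r"
    "g (x + t *\<^sub>R h + t *\<^sub>R w) - g (x + t *\<^sub>R h) - g (x + t *\<^sub>R w) + g x = t\<^sup>2 * P p"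
    using second_difference_mean_value[OF sm t0 t] unfolding P_def by blast
  obtain q where q: "q \<in> ball x r"
    "g (x + t *\<^sub>R w + t *\<^sub>R h) - g (x + t *\<^sub>R w) - g (x + t *\<^sub>R h) + g x = t\<^sup>2 * Q q"
    using second_difference_mean_value[OF sm t0, of w h] t unfolding Q_def by (auto simp: add.commute)
  have eq: "x + t *\<^sub>R h + t *\<^sub>R w = x + t *\<^sub>R w + t *\<^sub>R h" by simp
  have "t\<^sup>2 * P p = t\<^sup>2 * Q q" using p(2) q(2) unfolding eq by linarith
  then have "P p = Q q" using t0 by simp
  moreover have "dist (P p) (P x) < \<bar>P x - Q x\<bar> / 2" "dist (Q q) (Q x) < \<bar>P x - Q x\<bar> / 2"
    using p(1) q(1) r by (auto simp: r_def dist_commute)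
  ultimately show False by (simp add: dist_real_def abs_if split: if_splits)
qed

text \<open>Derivatives commute with the inner product against a fixed vector, and these products
  determine a vector. The vector-valued case is the one that changes of coordinates need.\<close>

lemma second_derivative_symmetric:
  fixes f :: "'e::real_inner \<Rightarrow> 'f::real_inner"
  assumes "open S" "x \<in> S" "smooth_on S f"
  shows "frechet_derivative (\<lambda>y. frechet_derivative f (at y) h) (at x) w =
    frechet_derivative (\<lambda>y. frechet_derivative f (at y) w) (at x) h"
proof -
  have comp: "frechet_derivative (\<lambda>y. frechet_derivative (\<lambda>z. f z \<bullet> b) (at y) h) (at x) w =
    frechet_derivative (\<lambda>y. frechet_derivative f (at y) h) (at x) w \<bullet> b" for b h w
  proof -
    have "frechet_derivative (\<lambda>z. f z \<bullet> b) (at y) h = frechet_derivative f (at y) h \<bullet> b" if "y \<in> S" for y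
      using frechet_derivative_bounded_linear_compose[OF bounded_linear_inner_left
          smooth_on_differentiable[OF assms(3) that]] .
    then have "frechet_derivative (\<lambda>y. frechet_derivative (\<lambda>z. f z \<bullet> b) (at y) h) (at x) =
      frechet_derivative (\<lambda>y. frechet_derivative f (at y) h \<bullet> b) (at x)"
      by (intro frechet_derivative_cong_open[OF assms(1,2)])
    then show ?thesis
      using frechet_derivative_bounded_linear_compose[OF bounded_linear_inner_left
          smooth_on_differentiable[OF smooth_on_frechet_derivative[OF assms(3)] assms(2)]] by simp
  qed
  have "smooth_on S (\<lambda>z. f z \<bullet> b)" for b
    by (rule smooth_on_bounded_linear[OF assms(1) bounded_linear_inner_left assms(3)])
  from second_derivative_symmetric_real[OF assms(1,2) this] show ?thesis
    unfolding comp by (intro iffD1[OF vector_eq_rdot]) blast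
qed

section \<open>Alternating maps\<close>

lemma linear_cmult: "linear L \<Longrightarrow> linear (\<lambda>u. (c::complex) * L u)"
  by (simp add: linear_iff algebra_simps)

lemma alternating_map_cong: "alternating_map k f \<Longrightarrow> (\<And>i. i < k \<Longrightarrow> v i = w i) \<Longrightarrow> f v = f w"
  by (simp add: alternating_map_def)

lemma alternating_map_linear: "alternating_map k f \<Longrightarrow> i < k \<Longrightarrow> linear (\<lambda>u. f (v(i := u)))"
  by (simp add: alternating_map_def)

lemma alternating_map_eq0:
  "alternating_map k f \<Longrightarrow> i < k \<Longrightarrow> j < k \<Longrightarrow> i \<noteq> j \<Longrightarrow> v i = v j \<Longrightarrow> f v = 0"
  unfolding alternating_map_def by blast

text \<open>Polarisation: expand \<open>f\<close> at the sequence with \<open>v i + v j\<close> in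
  both places.\<close>

lemma alternating_map_swap:
  assumes f: "alternating_map k f" and ij: "i < k" "j < k" "i \<noteq> j"
  shows "f (v(i := v j, j := v i)) = - f v"
proof -
  have lin1: "f (v(i := a + b, j := c)) = f (v(i := a, j := c)) + f (v(i := b, j := c))" for a b c
    using linear_add[OF alternating_map_linear[OF f ij(1), of "v(j := c)"], of a b] ij
    by (simp add: fun_upd_twist)
  have lin2: "f (v(i := c, j := a + b)) = f (v(i := c, j := a)) + f (v(i := c, j := b))" for a b c
    using linear_add[OF alternating_map_linear[OF f ij(2), of "v(i := c)"], of a b] by simp
  have 0: "f (v(i := a, j := a)) = 0" for a
    using alternating_map_eq0[OF f ij, of "v(i := a, j := a)"] ij by simp
  have "f (v(i := v j, j := v i)) + f (v(i := v i, j := v j)) = 0"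
    using 0[of "v i + v j"] 0[of "v i"] 0[of "v j"]
    unfolding lin1[of "v i" "v j"] lin2[of _ "v i" "v j"] by (simp only: add_0 add_0_right add.commute)
  then show ?thesis by (simp add: eq_neg_iff_add_eq_0)
qed

section \<open>Alternating sums over omitted entries\<close>

text \<open>The two shortened sequences differ only in the place of the common entry, and moving it
  there takes \<open>d\<close> swaps of neighbours.\<close>

lemma alternating_map_omit_shift:
  assumes f: "alternating_map k f"
  shows "i + Suc d \<le> k \<Longrightarrow> u i = u (i + Suc d) \<Longrightarrow> f (omit i u) = (- 1) ^ d * f (omit (i + Suc d) u)"
proof (induction d arbitrary: u)
  case 0
  then have "omit i u = omit (i + Suc 0) u"
    by (auto simp: omit_def fun_eq_iff less_Suc_eq)
  then show ?case by simp
next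
  case (Suc d)
  let ?j = "i + Suc d"
  \<comment> \<open>Exchanging two neighbours brings the repeated entry to position
    \<open>?j\<close>, where the induction hypothesis applies.\<close>
  let ?u = "u(?j := u (Suc ?j), Suc ?j := u ?j)"
  have "f (omit i ?u) = (- 1) ^ d * f (omit ?j ?u)"
    using Suc.prems by (intro Suc.IH) auto
  moreover have "omit ?j ?u = omit (i + Suc (Suc d)) u"
    by (auto simp: omit_def fun_eq_iff less_Suc_eq)
  moreover have "omit i ?u = (omit i u)(i + d := omit i u ?j, ?j := omit i u (i + d))"
    by (auto simp: omit_def fun_eq_iff)
  moreover have "f ((omit i u)(i + d := omit i u ?j, ?j := omit i u (i + d))) = - f (omit i u)"
    using Suc.prems by (intro alternating_map_swap[OF f]) auto
  ultimately show ?case by (metis minus_minus mult_minus_left mult.left_neutral power_Suc)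
qed

lemma alternating_map_omit_cancel:
  assumes f: "alternating_map k f" and "i < j" "j \<le> k" "u i = u j"
  shows "(- 1) ^ i * f (omit i u) + (- 1) ^ j * f (omit j u) = 0"
proof -
  obtain d where "j = i + Suc d" using assms(2) less_iff_Suc_add by auto
  then show ?thesis
    using alternating_map_omit_shift[OF f, of i d u] assms by (simp add: power_add)
qed

lemma omit_fun_upd:
  "l \<noteq> i \<Longrightarrow> omit i (v(l := a)) = (omit i v)((if l < i then l else l - 1) := a)"
  by (auto simp: omit_def fun_eq_iff)

lemma omit_fun_upd_same [simp]: "omit i (v(i := a)) = omit i v"
  by (auto simp: omit_def fun_eq_iff)

text \<open>With \<open>G h\<close> the derivative in direction \<open>h\<close>, this is the
  algebra behind \<open>ext_d_forms\<close>. If the entries \<open>i\<close> and \<open>j\<close>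
  agree, a term that omits neither still has a repeated entry, and the two other terms
  cancel.\<close>

lemma alternating_map_alternating_sum:
  assumes alt: "\<And>h. alternating_map k (G h)" and lin: "\<And>w. linear (\<lambda>h. G h w)"
  shows "alternating_map (Suc k) (\<lambda>v. \<Sum>i\<le>k. (- 1) ^ i * G (v i) (omit i v))"
  unfolding alternating_map_def
proof (intro conjI allI impI)
  fix v w :: "nat \<Rightarrow> 'a" assume "\<forall>i<Suc k. v i = w i"
  then show "(\<Sum>i\<le>k. (- 1) ^ i * G (v i) (omit i v)) = (\<Sum>i\<le>k. (- 1) ^ i * G (w i) (omit i w))"
    using alternating_map_cong[OF alt, of "omit _ v" "omit _ w"]
    by (intro sum.cong arg_cong2[of _ _ _ _ "(*)"]) (auto simp: omit_def)
next
  fix l and v :: "nat \<Rightarrow> 'a" assume l: "l < Suc k"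
  show "linear (\<lambda>u. \<Sum>i\<le>k. (- 1) ^ i * G ((v(l := u)) i) (omit i (v(l := u))))"
  proof (intro linear_compose_sum ballI linear_cmult)
    fix i assume "i \<in> {..k}"
    then show "linear (\<lambda>u. G ((v(l := u)) i) (omit i (v(l := u))))"
      using l lin alternating_map_linear[OF alt]
      by (cases "i = l") (auto simp: omit_fun_upd)
  qed
next
  fix v :: "nat \<Rightarrow> 'a" and i j assume ij: "i < Suc k" "j < Suc k" "i \<noteq> j \<and> v i = v j"
  have *: "(\<Sum>l\<le>k. (- 1) ^ l * G (v l) (omit l v)) = 0"
    if "i < j" "j \<le> k" "v i = v j" for i j
  proof -
    have "G (v l) (omit l v) = 0" if "l \<le> k" "l \<noteq> i" "l \<noteq> j" for l
      \<comment> \<open>Omitting position \<open>l\<close> lowers the later positions by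
        one.\<close>
      by (rule alternating_map_eq0[OF alt, of "if i < l then i else i - 1" "if j < l then j else j - 1"])
        (use that \<open>i < j\<close> \<open>j \<le> k\<close> \<open>v i = v j\<close> in \<open>auto simp: omit_def\<close>)
    then have "(\<Sum>l\<le>k. (- 1) ^ l * G (v l) (omit l v)) = (\<Sum>l\<in>{i, j}. (- 1) ^ l * G (v l) (omit l v))"
      using that by (intro sum.mono_neutral_right) auto
    also have "\<dots> = 0"
      using that alternating_map_omit_cancel[OF alt that(1,2), of v] by simp
    finally show ?thesis .
  qed
  show "(\<Sum>l\<le>k. (- 1) ^ l * G (v l) (omit l v)) = 0"
    using *[of i j] *[of j i] ij by (cases "i < j") auto
qed

text \<open>For \<open>Q\<close> the second derivative of a transition map, the sum is everything
  that could spoil the transformation law of d. Terms in which \<open>v i\<close> and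
  \<open>v j\<close> exchange their roles cancel in pairs.\<close>

lemma sum_omit_symmetric_eq0:
  fixes f :: "(nat \<Rightarrow> 'e::real_vector) \<Rightarrow> complex"
  assumes f: "alternating_map k f" and Q: "\<And>a b. Q a b = Q b a"
  shows "(\<Sum>i\<le>k. (- 1) ^ i * (\<Sum>l<k. f ((omit i w)(l := Q (v i) (omit i v l))))) = 0"
proof -
  define T where "T = (\<lambda>(i, l). (- 1) ^ i * f ((omit i w)(l := Q (v i) (omit i v l))))"
  define S where "S = {..k} \<times> {..<k}"
  define \<phi> where "\<phi> = (\<lambda>(i, l). if l < i then (l, i - 1) else (Suc l, i))"
  \<comment> \<open>If \<open>v j\<close> is the entry of \<open>omit i v\<close> at position \<open>l\<close>, then \<open>\<phi> (i, l)\<close> consists of \<open>j\<close> and the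
    position of \<open>v i\<close> in \<open>omit j v\<close>: \<open>\<phi>\<close> exchanges \<open>i\<close> and \<open>j\<close>.\<close>
  have invol: "\<phi> (\<phi> x) = x" "x \<in> S \<Longrightarrow> \<phi> x \<in> S" for x
    by (cases x; force simp: \<phi>_def S_def)+
  have anti: "T (l, i - 1) = - T (i, l)" if "l < i" "i \<le> k" for i l
  proof -
    \<comment> \<open>\<open>?u\<close> has the same vector at positions \<open>l\<close> and
      \<open>i\<close>; omitting one or the other gives the two terms of a pair, and
      \<open>alternating_map_omit_cancel\<close> gives them opposite signs.\<close>
    let ?u = "w(l := Q (v l) (v i), i := Q (v l) (v i))"
    have "omit l ?u = (omit l w)(i - 1 := Q (v l) (omit l v (i - 1)))"
      using that by (auto simp: omit_def fun_eq_iff)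
    moreover have "omit i ?u = (omit i w)(l := Q (v i) (omit i v l))"
      using that Q by (auto simp: omit_def fun_eq_iff)
    ultimately show ?thesis
      using alternating_map_omit_cancel[OF f that, of ?u] that
      by (simp add: T_def eq_neg_iff_add_eq_0)
  qed
  have anti': "T (\<phi> x) = - T x" if "x \<in> S" for x
  proof (cases "snd x < fst x")
    case True
    then show ?thesis using anti[of "snd x" "fst x"] that by (auto simp: \<phi>_def S_def)
  next
    case False
    then show ?thesis using anti[of "fst x" "Suc (snd x)"] that by (cases x) (auto simp: \<phi>_def S_def)
  qed
  have "sum T S = sum (\<lambda>x. T (\<phi> x)) S"
    by (rule sum.reindex_bij_witness[of _ \<phi> \<phi>]) (use invol in auto)
  also have "\<dots> = - sum T S"
    using anti' by (simp add: sum_negf)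
  finally have "sum T S = 0" by simp
  then show ?thesis
    by (simp add: S_def T_def sum_distrib_left flip: sum.cartesian_product)
qed

section \<open>Expansion in coordinates\<close>

text \<open>The arguments are expanded one after another by \<open>frame\<close>. The general index
  set serves both orthogonal coordinates and, in \<open>alternating_map_wedge_expansion\<close>,
  covectors of two types, where each frame vector occurs twice.\<close>

lemma multilinear_expansion:
  fixes f :: "(nat \<Rightarrow> 'e::real_vector) \<Rightarrow> complex"
  assumes f: "alternating_map k f"
    and fin: "finite \<Lambda>"
    and frame: "\<And>g v. linear g \<Longrightarrow> g v = (\<Sum>l\<in>\<Lambda>. \<theta> l v * g (e l) :: complex)"
  shows "f v = (\<Sum>j\<in>Pi\<^sub>E {..<k} (\<lambda>_. \<Lambda>). (\<Prod>i<k. \<theta> (j i) (v i)) * f (\<lambda>i. e (j i)))"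
proof -
  have "f v = (\<Sum>j\<in>Pi\<^sub>E {..<n} (\<lambda>_. \<Lambda>). (\<Prod>i<n. \<theta> (j i) (v i)) * f (\<lambda>i. if i < n then e (j i) else v i))"
    if "n \<le> k" for n
    using that
  proof (induction n)
    case (Suc n)
    have step: "f (\<lambda>i. if i < n then e (j i) else v i) =
      (\<Sum>l\<in>\<Lambda>. \<theta> l (v n) * f (\<lambda>i. if i < Suc n then e ((j(n := l)) i) else v i))" for j
    proof -
      let ?w = "\<lambda>i. if i < n then e (j i) else v i"
      have "linear (\<lambda>u. f (?w(n := u)))"
        using Suc.prems by (intro alternating_map_linear[OF f]) simp
      from frame[OF this, of "v n"] have "f (?w(n := v n)) = (\<Sum>l\<in>\<Lambda>. \<theta> l (v n) * f (?w(n := e l)))" .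
      moreover have "?w(n := v n) = ?w" by auto
      moreover have "?w(n := e l) = (\<lambda>i. if i < Suc n then e ((j(n := l)) i) else v i)" for l
        by (auto simp: fun_eq_iff)
      ultimately show ?thesis by simp
    qed
    have "f v = (\<Sum>j\<in>Pi\<^sub>E {..<n} (\<lambda>_. \<Lambda>). (\<Prod>i<n. \<theta> (j i) (v i)) * f (\<lambda>i. if i < n then e (j i) else v i))"
      using Suc by simp
    also have "\<dots> = (\<Sum>j\<in>Pi\<^sub>E {..<n} (\<lambda>_. \<Lambda>). \<Sum>l\<in>\<Lambda>. (\<Prod>i<Suc n. \<theta> ((j(n := l)) i) (v i)) *
        f (\<lambda>i. if i < Suc n then e ((j(n := l)) i) else v i))"
      unfolding step sum_distrib_left by (intro sum.cong refl) (simp add: mult_ac)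
    also have "\<dots> = (\<Sum>(l, j)\<in>\<Lambda> \<times> Pi\<^sub>E {..<n} (\<lambda>_. \<Lambda>). (\<Prod>i<Suc n. \<theta> ((j(n := l)) i) (v i)) *
        f (\<lambda>i. if i < Suc n then e ((j(n := l)) i) else v i))"
      by (subst sum.swap) (simp add: sum.cartesian_product)
    also have "\<dots> = (\<Sum>j\<in>Pi\<^sub>E {..<Suc n} (\<lambda>_. \<Lambda>). (\<Prod>i<Suc n. \<theta> (j i) (v i)) *
        f (\<lambda>i. if i < Suc n then e (j i) else v i))"
      unfolding lessThan_Suc[of n] PiE_insert_eq
      by (subst sum.reindex[OF inj_combinator]) (auto simp: o_def case_prod_unfold)
    finally show ?case .
  qed simp
  from this[of k] show ?thesis
    using alternating_map_cong[OF f, of "\<lambda>i. if i < k then e (_ i) else v i" "\<lambda>i. e (_ i)"] by simp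
qed

text \<open>Stands in for an orthonormal basis. The expansion formula is demanded directly, so
  vectors need not be normalised, and a zero vector contributes 0.\<close>

definition orthogonal_frame :: "'e::real_inner set \<Rightarrow> bool" where
  "orthogonal_frame B \<longleftrightarrow> finite B \<and> (\<forall>x. (\<Sum>b\<in>B. (x \<bullet> b / (b \<bullet> b)) *\<^sub>R b) = x)"

definition coord :: "'e::real_inner \<Rightarrow> 'e \<Rightarrow> complex" where
  "coord b x = of_real (x \<bullet> b / (b \<bullet> b))"

lemma bounded_linear_coord: "bounded_linear (coord b)"
proof -
  have "bounded_linear (\<lambda>x. complex_of_real ((x \<bullet> b) * inverse (b \<bullet> b)))"
    by (intro bounded_linear_compose[OF bounded_linear_of_real]
        bounded_linear_compose[OF bounded_linear_mult_left] bounded_linear_inner_left)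
  then show ?thesis by (simp add: coord_def[abs_def] divide_inverse)
qed

lemma orthogonal_frame_expand:
  assumes "orthogonal_frame B" "linear g"
  shows "g v = (\<Sum>b\<in>B. coord b v * g b)"
proof -
  have "g v = g (\<Sum>b\<in>B. (v \<bullet> b / (b \<bullet> b)) *\<^sub>R b)"
    using assms(1) by (simp add: orthogonal_frame_def)
  also have "\<dots> = (\<Sum>b\<in>B. coord b v * g b)"
    by (simp add: linear_sum[OF assms(2)] linear_cmul[OF assms(2)] coord_def scaleR_conv_of_real)
  finally show ?thesis .
qed

text \<open>Orthogonality reduces the expansion of a vector of \<open>C\<close> to one term; both
  sides being linear, the formula holds on the span.\<close>

lemma orthogonal_frame_exists:
  assumes "has_dimension TYPE('e::real_inner) n"
  obtains B :: "'e::real_inner set" where "orthogonal_frame B"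
proof -
  obtain B0 :: "'e set" where B0: "finite B0" "span B0 = UNIV"
    using assms unfolding has_dimension_def by blast
  obtain C :: "'e set" where C: "finite C" "span C = UNIV" "pairwise orthogonal C"
    using basis_orthogonal[OF B0(1)] B0(2) by metis
  have "(\<Sum>b\<in>C. (x \<bullet> b / (b \<bullet> b)) *\<^sub>R b) = x" for x
  proof -
    have "x \<in> span C" using C by simp
    then show ?thesis
    proof (induction rule: span_induct_alt)
      case (step c x y)
      have "(\<Sum>b\<in>C. (x \<bullet> b / (b \<bullet> b)) *\<^sub>R b) = (\<Sum>b\<in>C. if b = x then x else 0)"
        using C(3) \<open>x \<in> C\<close> by (intro sum.cong) (auto simp: pairwise_def orthogonal_def)
      also have "\<dots> = x" using C(1) \<open>x \<in> C\<close> by simp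
      finally have "c *\<^sub>R (\<Sum>b\<in>C. (x \<bullet> b / (b \<bullet> b)) *\<^sub>R b) = c *\<^sub>R x" by simp
      then show ?case
        using step.IH by (simp add: inner_add_left add_divide_distrib scaleR_left_distrib sum.distrib scaleR_sum_right)
    qed simp
  qed
  then show thesis using that C(1) unfolding orthogonal_frame_def by blast
qed

lemma alternating_map_expand_orthogonal_frame:
  assumes "orthogonal_frame B" "alternating_map k f"
  shows "f v = (\<Sum>j\<in>Pi\<^sub>E {..<k} (\<lambda>_. B). (\<Prod>i<k. coord (j i) (v i)) * f j)"
  using multilinear_expansion[OF assms(2), of B coord "\<lambda>b. b" v] orthogonal_frame_expand[OF assms(1)] assms(1)
  by (simp add: orthogonal_frame_def)

section \<open>Derivatives of alternating maps\<close>

text \<open>The product rule when both the alternating map and its arguments vary. In coordinates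
  \<open>F y (g y)\<close> is a finite sum of products, so the ordinary rule applies;
  \<open>F'_expand\<close> and \<open>upd_expand\<close> recognise the resulting terms.\<close>

lemma has_derivative_alternating_apply:
  fixes F :: "'e::real_inner \<Rightarrow> (nat \<Rightarrow> 'e) \<Rightarrow> complex" and B :: "'e set"
  assumes B: "orthogonal_frame B" and U: "open U" "x \<in> U"
    and alt: "\<And>y. y \<in> U \<Longrightarrow> alternating_map k (F y)"
    and F': "\<And>w. ((\<lambda>y. F y w) has_derivative F' w) (at x)"
    and g': "\<And>i. i < k \<Longrightarrow> ((\<lambda>y. g y i) has_derivative g' i) (at x)"
  shows "((\<lambda>y. F y (g y)) has_derivative
    (\<lambda>h. F' (g x) h + (\<Sum>i<k. F x ((g x)(i := g' i h))))) (at x)"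
proof -
  let ?P = "Pi\<^sub>E {..<k} (\<lambda>_. B)"
  have expand: "F y v = (\<Sum>j\<in>?P. (\<Prod>i<k. coord (j i) (v i)) * F y j)" if "y \<in> U" for y v
    by (rule alternating_map_expand_orthogonal_frame[OF B alt[OF that]])
  \<comment> \<open>The derivative inherits the expansion of \<open>F\<close> because derivatives
    are unique.\<close>
  have F'_expand: "F' w h = (\<Sum>j\<in>?P. (\<Prod>i<k. coord (j i) (w i)) * F' j h)" for w h
  proof -
    have "((\<lambda>y. \<Sum>j\<in>?P. (\<Prod>i<k. coord (j i) (w i)) * F y j) has_derivative
        (\<lambda>h. \<Sum>j\<in>?P. (\<Prod>i<k. coord (j i) (w i)) * F' j h)) (at x)"
      by (intro has_derivative_sum has_derivative_mult_right F')
    then have "((\<lambda>y. F y w) has_derivative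
        (\<lambda>h. \<Sum>j\<in>?P. (\<Prod>i<k. coord (j i) (w i)) * F' j h)) (at x)"
      by (rule has_derivative_transform_within_open[OF _ U]) (rule expand[symmetric])
    from has_derivative_unique[OF F' this] show ?thesis by meson
  qed
  have upd_expand: "F x ((g x)(i := u)) =
      (\<Sum>j\<in>?P. coord (j i) u * (\<Prod>l\<in>{..<k} - {i}. coord (j l) (g x l)) * F x j)" if "i < k" for i u
    unfolding expand[OF U(2), of "(g x)(i := u)"]
    using that by (intro sum.cong refl) (simp add: prod.remove[of _ i])
  have "((\<lambda>y. \<Sum>j\<in>?P. (\<Prod>i<k. coord (j i) (g y i)) * F y j) has_derivative
      (\<lambda>h. \<Sum>j\<in>?P. (\<Prod>i<k. coord (j i) (g x i)) * F' j h +
         (\<Sum>i<k. coord (j i) (g' i h) * (\<Prod>l\<in>{..<k} - {i}. coord (j l) (g x l))) * F x j)) (at x)"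
    by (intro has_derivative_sum has_derivative_mult has_derivative_prod F'
        bounded_linear.has_derivative[OF bounded_linear_coord] g') simp_all
  then have *: "((\<lambda>y. F y (g y)) has_derivative
      (\<lambda>h. \<Sum>j\<in>?P. (\<Prod>i<k. coord (j i) (g x i)) * F' j h +
         (\<Sum>i<k. coord (j i) (g' i h) * (\<Prod>l\<in>{..<k} - {i}. coord (j l) (g x l))) * F x j)) (at x)"
    by (rule has_derivative_transform_within_open[OF _ U]) (rule expand[symmetric])
  have "(\<Sum>i<k. F x ((g x)(i := g' i h))) =
      (\<Sum>j\<in>?P. (\<Sum>i<k. coord (j i) (g' i h) * (\<Prod>l\<in>{..<k} - {i}. coord (j l) (g x l))) * F x j)" for h
    by (subst sum_distrib_right, subst sum.swap) (simp add: upd_expand)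
  with * show ?thesis by (simp add: F'_expand[of "g x"] sum.distrib)
qed

text \<open>Each clause of \<open>alternating_map\<close> for \<open>F y\<close> is a linear
  relation between functions of \<open>y\<close> that holds near \<open>x\<close>, and such
  relations can be differentiated.\<close>

lemma alternating_map_frechet_derivative:
  fixes F :: "'e::real_inner \<Rightarrow> (nat \<Rightarrow> 'f::real_vector) \<Rightarrow> complex"
  assumes U: "open U" "x \<in> U"
    and alt: "\<And>y. y \<in> U \<Longrightarrow> alternating_map k (F y)"
    and diff: "\<And>w. (\<lambda>y. F y w) differentiable (at x)"
  shows "alternating_map k (\<lambda>w. frechet_derivative (\<lambda>y. F y w) (at x) h)"
  unfolding alternating_map_def
proof (intro conjI allI impI)
  fix v w :: "nat \<Rightarrow> 'f" assume "\<forall>i<k. v i = w i"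
  then have "F y v = F y w" if "y \<in> U" for y
    using alternating_map_cong[OF alt[OF that]] by blast
  then have "frechet_derivative (\<lambda>y. F y v) (at x) = frechet_derivative (\<lambda>y. F y w) (at x)"
    by (rule frechet_derivative_cong_open[OF U])
  then show "frechet_derivative (\<lambda>y. F y v) (at x) h = frechet_derivative (\<lambda>y. F y w) (at x) h"
    by simp
next
  fix i and v :: "nat \<Rightarrow> 'f" assume "i < k"
  then have lin: "linear (\<lambda>u. F y (v(i := u)))" if "y \<in> U" for y
    by (rule alternating_map_linear[OF alt[OF that]])
  note D = diff[unfolded frechet_derivative_works]
  show "linear (\<lambda>u. frechet_derivative (\<lambda>y. F y (v(i := u))) (at x) h)"
  proof (rule linearI)
    fix a b
    have "frechet_derivative (\<lambda>y. F y (v(i := a + b))) (at x) =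
        frechet_derivative (\<lambda>y. F y (v(i := a)) + F y (v(i := b))) (at x)"
      by (rule frechet_derivative_cong_open[OF U]) (rule linear_add[OF lin])
    also have "\<dots> = (\<lambda>h. frechet_derivative (\<lambda>y. F y (v(i := a))) (at x) h +
        frechet_derivative (\<lambda>y. F y (v(i := b))) (at x) h)"
      by (rule frechet_derivative_eqI[OF has_derivative_add[OF D D]])
    finally show "frechet_derivative (\<lambda>y. F y (v(i := a + b))) (at x) h =
      frechet_derivative (\<lambda>y. F y (v(i := a))) (at x) h + frechet_derivative (\<lambda>y. F y (v(i := b))) (at x) h"
      by simp
  next
    fix r a
    have "frechet_derivative (\<lambda>y. F y (v(i := r *\<^sub>R a))) (at x) =
        frechet_derivative (\<lambda>y. r *\<^sub>R F y (v(i := a))) (at x)"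
      by (rule frechet_derivative_cong_open[OF U]) (rule linear_cmul[OF lin])
    also have "\<dots> = (\<lambda>h. r *\<^sub>R frechet_derivative (\<lambda>y. F y (v(i := a))) (at x) h)"
      by (rule frechet_derivative_eqI[OF has_derivative_scaleR_right[OF D]])
    finally show "frechet_derivative (\<lambda>y. F y (v(i := r *\<^sub>R a))) (at x) h =
        r *\<^sub>R frechet_derivative (\<lambda>y. F y (v(i := a))) (at x) h"
      by simp
  qed
next
  fix v :: "nat \<Rightarrow> 'f" and i j assume "i < k" "j < k" "i \<noteq> j \<and> v i = v j"
  then have "F y v = 0" if "y \<in> U" for y
    using alternating_map_eq0[OF alt[OF that]] by blast
  then have "frechet_derivative (\<lambda>y. F y v) (at x) = frechet_derivative (\<lambda>y. 0) (at x)"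
    by (rule frechet_derivative_cong_open[OF U])
  then show "frechet_derivative (\<lambda>y. F y v) (at x) h = 0" by simp
qed

lemma alternating_map_zero: "alternating_map k 0"
  by (simp add: alternating_map_def linear_iff)

lemma alternating_mapI:
  assumes "\<And>v w. (\<And>i. i < k \<Longrightarrow> v i = w i) \<Longrightarrow> f v = f w"
    and "\<And>i v. i < k \<Longrightarrow> linear (\<lambda>u. f (v(i := u)))"
    and "\<And>v i j. i < k \<Longrightarrow> j < k \<Longrightarrow> i \<noteq> j \<Longrightarrow> v i = v j \<Longrightarrow> f v = 0"
  shows "alternating_map k f"
  unfolding alternating_map_def
proof (intro conjI allI impI)
  show "f v = f w" if "\<forall>i<k. v i = w i" for v w
    by (rule assms(1)) (use that in simp)
  show "linear (\<lambda>u. f (v(i := u)))" if "i < k" for i v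
    by (rule assms(2)[OF that])
  show "f v = 0" if "i < k" "j < k" "i \<noteq> j \<and> v i = v j" for v i j
    by (rule assms(3)[of i j]) (use that in simp_all)
qed

lemma alternating_map_add:
  assumes f: "alternating_map k f" and g: "alternating_map k g"
  shows "alternating_map k (f + g)"
proof (rule alternating_mapI)
  fix v w :: "nat \<Rightarrow> 'a" assume "\<And>i. i < k \<Longrightarrow> v i = w i"
  then show "(f + g) v = (f + g) w"
    using alternating_map_cong[OF f, of v w] alternating_map_cong[OF g, of v w] by simp
next
  fix i and v :: "nat \<Rightarrow> 'a" assume i: "i < k"
  show "linear (\<lambda>u. (f + g) (v(i := u)))"
    unfolding plus_fun_apply
    by (rule linear_compose_add[OF alternating_map_linear[OF f i] alternating_map_linear[OF g i]])
next
  fix v :: "nat \<Rightarrow> 'a" and i j assume "i < k" "j < k" "i \<noteq> j" "v i = v j"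
  then show "(f + g) v = 0"
    using alternating_map_eq0[OF f] alternating_map_eq0[OF g] by simp
qed

lemma alternating_map_cmult:
  assumes f: "alternating_map k f"
  shows "alternating_map k (\<lambda>v. z * f v)"
proof (rule alternating_mapI)
  fix v w :: "nat \<Rightarrow> 'a" assume "\<And>i. i < k \<Longrightarrow> v i = w i"
  then show "z * f v = z * f w"
    using alternating_map_cong[OF f, of v w] by simp
next
  fix i and v :: "nat \<Rightarrow> 'a" assume i: "i < k"
  show "linear (\<lambda>u. z * f (v(i := u)))"
    by (rule linear_cmult[OF alternating_map_linear[OF f i]])
next
  fix v :: "nat \<Rightarrow> 'a" and i j assume "i < k" "j < k" "i \<noteq> j" "v i = v j"
  then show "z * f v = 0"
    using alternating_map_eq0[OF f] by simp
qed

lemma alternating_map_compose_linear: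
  fixes f :: "(nat \<Rightarrow> 'f::real_vector) \<Rightarrow> complex" and L :: "'e::real_vector \<Rightarrow> 'f"
  assumes f: "alternating_map k f" and L: "linear L"
  shows "alternating_map k (\<lambda>v. f (\<lambda>i. L (v i)))"
  unfolding alternating_map_def
proof (intro conjI allI impI)
  fix v w :: "nat \<Rightarrow> 'e" assume "\<forall>i<k. v i = w i"
  then show "f (\<lambda>i. L (v i)) = f (\<lambda>i. L (w i))"
    by (intro alternating_map_cong[OF f]) simp
next
  fix i and v :: "nat \<Rightarrow> 'e" assume "i < k"
  then have "linear (\<lambda>u. f ((\<lambda>j. L (v j))(i := u)))" by (rule alternating_map_linear[OF f])
  from linear_compose[OF L this] have "linear (\<lambda>u. f ((\<lambda>j. L (v j))(i := L u)))"
    by (simp add: o_def)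
  moreover have "(\<lambda>j. L (v j))(i := L u) = (\<lambda>j. L ((v(i := u)) j))" for u
    by auto
  ultimately show "linear (\<lambda>u. f (\<lambda>j. L ((v(i := u)) j)))"
    by simp
next
  fix v :: "nat \<Rightarrow> 'e" and i j assume "i < k" "j < k" "i \<noteq> j \<and> v i = v j"
  then show "f (\<lambda>i. L (v i)) = 0"
    by (intro alternating_map_eq0[OF f, of i j]) auto
qed

section \<open>Forms on a manifold\<close>

lemma chart_overlap_open:
  assumes "is_chart X c" "is_chart X c'"
  shows "open (snd c ` (fst c \<inter> fst c'))"
proof -
  have "openin (subtopology X (fst c)) (fst c \<inter> fst c')"
    using assms by (simp add: is_chart_def openin_subtopology_Int2)
  moreover have "open_map (subtopology X (fst c)) (top_of_set (chart_image c)) (snd c)"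
    using assms by (simp add: is_chart_def homeomorphic_imp_open_map)
  ultimately have "openin (top_of_set (chart_image c)) (snd c ` (fst c \<inter> fst c'))"
    by (simp add: open_map_def)
  then show ?thesis using assms by (meson is_chart_def openin_open_trans)
qed

lemma chart_inj_on:
  assumes "is_chart X c"
  shows "inj_on (snd c) (fst c)"
proof -
  have "fst c \<subseteq> topspace X" using assms by (simp add: is_chart_def openin_subset)
  then show ?thesis
    using assms homeomorphic_imp_injective_map[of "subtopology X (fst c)"]
    unfolding is_chart_def by (metis inf.absorb_iff2 topspace_subtopology)
qed

lemma transition_apply:
  "is_chart X c \<Longrightarrow> p \<in> fst c \<Longrightarrow> transition c c' (snd c p) = snd c' p"
  by (simp add: transition_def inv_into_f_f[OF chart_inj_on])

lemma
  assumes "\<alpha> \<in> forms A k"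
  shows forms_alternating: "c \<in> A \<Longrightarrow> x \<in> chart_image c \<Longrightarrow> alternating_map k (\<alpha> c x)"
    and forms_smooth: "c \<in> A \<Longrightarrow> smooth_on (chart_image c) (\<lambda>x. \<alpha> c x v)"
    and forms_transition: "c \<in> A \<Longrightarrow> c' \<in> A \<Longrightarrow> p \<in> fst c \<Longrightarrow> p \<in> fst c' \<Longrightarrow>
      \<alpha> c (snd c p) v = \<alpha> c' (snd c' p) (\<lambda>i. dtransition c c' p (v i))"
    and forms_outside: "\<not> (c \<in> A \<and> x \<in> chart_image c) \<Longrightarrow> \<alpha> c x = 0"
proof -
  note * = assms[unfolded forms_def mem_Collect_eq]
  show "alternating_map k (\<alpha> c x)" if "c \<in> A" "x \<in> chart_image c"
    using that by (rule *[THEN conjunct1, THEN bspec, THEN bspec])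
  show "smooth_on (chart_image c) (\<lambda>x. \<alpha> c x v)" if "c \<in> A"
    using that by (rule *[THEN conjunct2, THEN conjunct1, THEN bspec, THEN spec])
  show "\<alpha> c (snd c p) v = \<alpha> c' (snd c' p) (\<lambda>i. dtransition c c' p (v i))"
    if "c \<in> A" "c' \<in> A" "p \<in> fst c" "p \<in> fst c'"
    using that(1,2) IntI[OF that(3,4)]
    by (rule *[THEN conjunct2, THEN conjunct2, THEN conjunct1, THEN bspec, THEN bspec, THEN bspec, THEN spec])
  show "\<alpha> c x = 0" if "\<not> (c \<in> A \<and> x \<in> chart_image c)"
    using that by (rule *[THEN conjunct2, THEN conjunct2, THEN conjunct2, THEN spec, THEN spec, THEN mp])
qed

lemma
  assumes "smooth_endo_field A E"
  shows endo_field_linear: "c \<in> A \<Longrightarrow> x \<in> chart_image c \<Longrightarrow> linear (E c x)"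
    and endo_field_smooth: "c \<in> A \<Longrightarrow> smooth_on (chart_image c) (\<lambda>x. E c x v)"
    and endo_field_transition: "c \<in> A \<Longrightarrow> c' \<in> A \<Longrightarrow> p \<in> fst c \<Longrightarrow> p \<in> fst c' \<Longrightarrow>
      dtransition c c' p (E c (snd c p) v) = E c' (snd c' p) (dtransition c c' p v)"
proof -
  note * = assms[unfolded smooth_endo_field_def]
  show "linear (E c x)" if "c \<in> A" "x \<in> chart_image c"
    using that by (rule *[THEN conjunct1, THEN bspec, THEN bspec])
  show "smooth_on (chart_image c) (\<lambda>x. E c x v)" if "c \<in> A"
    using that by (rule *[THEN conjunct2, THEN conjunct1, THEN bspec, THEN spec])
  show "dtransition c c' p (E c (snd c p) v) = E c' (snd c' p) (dtransition c c' p v)"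
    if "c \<in> A" "c' \<in> A" "p \<in> fst c" "p \<in> fst c'"
    using that(1,2) IntI[OF that(3,4)]
    by (rule *[THEN conjunct2, THEN conjunct2, THEN bspec, THEN bspec, THEN bspec, THEN spec])
qed

lemma formsI:
  assumes "\<And>c x. c \<in> A \<Longrightarrow> x \<in> chart_image c \<Longrightarrow> alternating_map k (\<alpha> c x)"
    and "\<And>c v. c \<in> A \<Longrightarrow> smooth_on (chart_image c) (\<lambda>x. \<alpha> c x v)"
    and "\<And>c c' p v. c \<in> A \<Longrightarrow> c' \<in> A \<Longrightarrow> p \<in> fst c \<Longrightarrow> p \<in> fst c' \<Longrightarrow>
      \<alpha> c (snd c p) v = \<alpha> c' (snd c' p) (\<lambda>i. dtransition c c' p (v i))"
    and "\<And>c x. \<not> (c \<in> A \<and> x \<in> chart_image c) \<Longrightarrow> \<alpha> c x = 0"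
  shows "\<alpha> \<in> forms A k"
  unfolding forms_def mem_Collect_eq
  by (intro conjI ballI allI impI; (elim IntE)?; rule assms; assumption)

lemma J_form_add: "J_form E (\<alpha> + \<beta>) = J_form E \<alpha> + J_form E \<beta>"
  by (simp add: J_form_def fun_eq_iff)

lemma J_form_scale: "J_form E (scale_form z \<alpha>) = scale_form z (J_form E \<alpha>)"
  by (simp add: J_form_def scale_form_def)

context
  fixes n :: nat and X :: "'a topology" and A :: "('a, 'e::real_inner) chart set"
  assumes M: "smooth_manifold n X A"
begin

lemma manifold_chart: "c \<in> A \<Longrightarrow> is_chart X c"
  using M by (simp add: smooth_manifold_def)

lemma manifold_chart_image_open: "c \<in> A \<Longrightarrow> open (chart_image c)"
  using manifold_chart by (simp add: is_chart_def)

lemma manifold_orthogonal_frame: obtains B :: "'e set" where "orthogonal_frame B"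
proof -
  have "has_dimension TYPE('e) n" using M by (simp add: smooth_manifold_def)
  then show thesis by (rule orthogonal_frame_exists) (rule that)
qed

lemma transition_smooth:
  "c \<in> A \<Longrightarrow> c' \<in> A \<Longrightarrow> smooth_on (snd c ` (fst c \<inter> fst c')) (transition c c')"
  using M by (simp add: smooth_manifold_def)

lemma dtransition_linear:
  assumes "c \<in> A" "c' \<in> A" "p \<in> fst c" "p \<in> fst c'"
  shows "linear (dtransition c c' p)"
  unfolding dtransition_def
  by (rule has_derivative_linear[OF smooth_on_has_derivative[OF transition_smooth[OF assms(1,2)]]])
     (use assms in simp)

lemma forms_zero: "0 \<in> forms A k"
  by (rule formsI) (simp_all add: alternating_map_zero smooth_on_const)

lemma forms_add:
  assumes \<alpha>: "\<alpha> \<in> forms A k" and \<beta>: "\<beta> \<in> forms A k"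
  shows "\<alpha> + \<beta> \<in> forms A k"
proof (rule formsI)
  fix c c' p v assume c: "c \<in> A" "c' \<in> A" "p \<in> fst c" "p \<in> fst c'"
  show "(\<alpha> + \<beta>) c (snd c p) v = (\<alpha> + \<beta>) c' (snd c' p) (\<lambda>i. dtransition c c' p (v i))"
    using forms_transition[OF \<alpha> c] forms_transition[OF \<beta> c] by simp
next
  fix c x assume c: "c \<in> A" "x \<in> chart_image c"
  show "alternating_map k ((\<alpha> + \<beta>) c x)"
    unfolding plus_fun_apply[of \<alpha>] plus_fun_apply[of "\<alpha> c"]
    by (rule alternating_map_add[OF forms_alternating[OF \<alpha> c] forms_alternating[OF \<beta> c]])
next
  fix c v assume c: "c \<in> A"
  show "smooth_on (chart_image c) (\<lambda>x. (\<alpha> + \<beta>) c x v)"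
    unfolding plus_fun_apply
    by (rule smooth_on_add[OF manifold_chart_image_open[OF c] forms_smooth[OF \<alpha> c] forms_smooth[OF \<beta> c]])
next
  fix c x assume c: "\<not> (c \<in> A \<and> x \<in> chart_image c)"
  show "(\<alpha> + \<beta>) c x = 0"
    using forms_outside[OF \<alpha> c] forms_outside[OF \<beta> c] by simp
qed

lemma forms_scale:
  assumes \<alpha>: "\<alpha> \<in> forms A k"
  shows "scale_form z \<alpha> \<in> forms A k"
proof (rule formsI)
  fix c c' p v assume c: "c \<in> A" "c' \<in> A" "p \<in> fst c" "p \<in> fst c'"
  show "scale_form z \<alpha> c (snd c p) v = scale_form z \<alpha> c' (snd c' p) (\<lambda>i. dtransition c c' p (v i))"
    using forms_transition[OF \<alpha> c] by (simp add: scale_form_def)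
next
  fix c x assume c: "c \<in> A" "x \<in> chart_image c"
  show "alternating_map k (scale_form z \<alpha> c x)"
    unfolding scale_form_def by (rule alternating_map_cmult[OF forms_alternating[OF \<alpha> c]])
next
  fix c v assume c: "c \<in> A"
  show "smooth_on (chart_image c) (\<lambda>x. scale_form z \<alpha> c x v)"
    unfolding scale_form_def
    by (rule smooth_on_mult[OF manifold_chart_image_open[OF c] smooth_on_const forms_smooth[OF \<alpha> c]])
next
  fix c x assume "\<not> (c \<in> A \<and> x \<in> chart_image c)"
  from forms_outside[OF \<alpha> this] show "scale_form z \<alpha> c x = 0"
    by (simp add: scale_form_def fun_eq_iff)
qed

text \<open>Besides \<open>J\<close> itself, \<open>E\<close> will be \<open>- J\<close>, which
  inverts it on forms, and the rotations cos t + sin t J, which produce the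
  (p,q)-components.\<close>

lemma J_form_forms:
  assumes E: "smooth_endo_field A E" and \<alpha>: "\<alpha> \<in> forms A k"
  shows "J_form E \<alpha> \<in> forms A k"
proof (rule formsI)
  fix c x assume c: "c \<in> A" "x \<in> chart_image c"
  show "alternating_map k (J_form E \<alpha> c x)"
    unfolding J_form_def
    by (rule alternating_map_compose_linear[OF forms_alternating[OF \<alpha> c] endo_field_linear[OF E c]])
next
  fix c v assume c: "c \<in> A"
  note op = manifold_chart_image_open[OF c]
  obtain B :: "'e set" where B: "orthogonal_frame B" by (rule manifold_orthogonal_frame)
  \<comment> \<open>The arguments \<open>E c x (v i)\<close> move with \<open>x\<close>, while
    smoothness of \<alpha> is given for fixed arguments; the expansion separates the two
    dependences.\<close>
  show "smooth_on (chart_image c) (\<lambda>x. J_form E \<alpha> c x v)"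
  proof (rule smooth_on_cong[OF op])
    show "(\<Sum>j\<in>Pi\<^sub>E {..<k} (\<lambda>_. B). (\<Prod>i<k. coord (j i) (E c x (v i))) * \<alpha> c x j) = J_form E \<alpha> c x v"
      if "x \<in> chart_image c" for x
      unfolding J_form_def
      by (rule alternating_map_expand_orthogonal_frame[OF B forms_alternating[OF \<alpha> c that], symmetric])
    show "smooth_on (chart_image c)
        (\<lambda>x. \<Sum>j\<in>Pi\<^sub>E {..<k} (\<lambda>_. B). (\<Prod>i<k. coord (j i) (E c x (v i))) * \<alpha> c x j)"
      by (rule smooth_on_sum[OF op], rule smooth_on_mult[OF op _ forms_smooth[OF \<alpha> c]],
          rule smooth_on_prod[OF op],
          rule smooth_on_bounded_linear[OF op bounded_linear_coord endo_field_smooth[OF E c]])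
  qed
next
  fix c c' p v assume c: "c \<in> A" "c' \<in> A" "p \<in> fst c" "p \<in> fst c'"
  show "J_form E \<alpha> c (snd c p) v = J_form E \<alpha> c' (snd c' p) (\<lambda>i. dtransition c c' p (v i))"
    unfolding J_form_def forms_transition[OF \<alpha> c] endo_field_transition[OF E c] by (rule refl)
next
  fix c x assume "\<not> (c \<in> A \<and> x \<in> chart_image c)"
  from forms_outside[OF \<alpha> this] show "J_form E \<alpha> c x = 0"
    by (simp add: J_form_def fun_eq_iff)
qed

text \<open>Provides \<open>- J\<close> and, with \<open>a = cos t\<close> and
  \<open>b = sin t\<close>, the rotations.\<close>

lemma smooth_endo_field_lincomb:
  assumes E: "smooth_endo_field A E"
  shows "smooth_endo_field A (\<lambda>c x v. a *\<^sub>R v + b *\<^sub>R E c x v)"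
  unfolding smooth_endo_field_def
proof (intro conjI ballI allI)
  fix c x assume c: "c \<in> A" "x \<in> chart_image c"
  show "linear (\<lambda>v. a *\<^sub>R v + b *\<^sub>R E c x v)"
    using endo_field_linear[OF E c] by (simp add: linear_iff algebra_simps)
next
  fix c v assume c: "c \<in> A"
  note op = manifold_chart_image_open[OF c]
  show "smooth_on (chart_image c) (\<lambda>x. a *\<^sub>R v + b *\<^sub>R E c x v)"
    by (rule smooth_on_add[OF op smooth_on_const
          smooth_on_bounded_linear[OF op bounded_linear_scaleR_right endo_field_smooth[OF E c]]])
next
  fix c c' p v assume c: "c \<in> A" "c' \<in> A" "p \<in> fst c \<inter> fst c'"
  then show "dtransition c c' p (a *\<^sub>R v + b *\<^sub>R E c (snd c p) v) =
    a *\<^sub>R dtransition c c' p v + b *\<^sub>R E c' (snd c' p) (dtransition c c' p v)"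
    using dtransition_linear[of c c' p] endo_field_transition[OF E, of c c' p v]
    by (simp add: linear_add linear_cmul)
qed

section \<open>The exterior derivative\<close>

lemma forms_has_derivative:
  assumes "\<alpha> \<in> forms A k" "c \<in> A" "x \<in> chart_image c"
  shows "((\<lambda>y. \<alpha> c y w) has_derivative frechet_derivative (\<lambda>y. \<alpha> c y w) (at x)) (at x)"
  using smooth_on_has_derivative[OF forms_smooth] assms by blast

text \<open>Differentiating the transformation law of \<alpha> gives the pulled-back derivative
  plus, for each argument, a term with the second derivative of the transition map. By symmetry of
  that derivative the extra terms cancel in the alternating sum.\<close>

lemma ext_d_transition:
  assumes \<alpha>: "\<alpha> \<in> forms A k" and c: "c \<in> A" "c' \<in> A" "p \<in> fst c" "p \<in> fst c'"
  shows "ext_d A k \<alpha> c (snd c p) v = ext_d A k \<alpha> c' (snd c' p) (\<lambda>i. dtransition c c' p (v i))"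
proof -
  define U where "U = snd c ` (fst c \<inter> fst c')"
  define \<tau> where "\<tau> = transition c c'"
  define D where "D y = frechet_derivative \<tau> (at y)" for y
  define x where "x = snd c p"
  have U: "open U" "x \<in> U"
    using c chart_overlap_open[OF manifold_chart manifold_chart] by (auto simp: U_def x_def)
  have \<tau>: "smooth_on U \<tau>" using transition_smooth[OF c(1,2)] by (simp add: U_def \<tau>_def)
  have \<tau>_apply: "\<tau> (snd c q) = snd c' q" if "q \<in> fst c" for q
    using transition_apply[OF manifold_chart[OF c(1)] that] by (simp add: \<tau>_def)
  have \<tau>_image: "\<tau> y \<in> chart_image c'" if "y \<in> U" for y
    using that \<tau>_apply by (auto simp: U_def chart_image_def)
  have x: "x \<in> chart_image c" "\<tau> x = snd c' p" "dtransition c c' p = D x"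
    using c \<tau>_apply by (auto simp: x_def chart_image_def D_def \<tau>_def dtransition_def)
  \<comment> \<open>The transformation law on the whole overlap, as an identity of functions of
    \<open>y\<close> that can be differentiated at \<open>x\<close>.\<close>
  have pull: "\<alpha> c' (\<tau> y) (\<lambda>i. D y (w i)) = \<alpha> c y w" if "y \<in> U" for y w
    using that forms_transition[OF \<alpha> c(1,2)] \<tau>_apply
    by (auto simp: U_def D_def \<tau>_def dtransition_def)
  obtain B :: "'e set" where B: "orthogonal_frame B" by (rule manifold_orthogonal_frame)
  define Q where "Q h u = frechet_derivative (\<lambda>y. D y u) (at x) h" for h u
  have Q_sym: "Q h u = Q u h" for h u
    unfolding Q_def D_def by (rule second_derivative_symmetric[OF U \<tau>])
  have deriv: "frechet_derivative (\<lambda>y. \<alpha> c y w) (at x) h =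
      frechet_derivative (\<lambda>z. \<alpha> c' z (\<lambda>i. D x (w i))) (at (\<tau> x)) (D x h) +
      (\<Sum>l<k. \<alpha> c' (\<tau> x) ((\<lambda>i. D x (w i))(l := Q h (w l))))" for w h
  proof -
    have "((\<lambda>y. \<alpha> c' (\<tau> y) (\<lambda>i. D y (w i))) has_derivative
        (\<lambda>h. frechet_derivative (\<lambda>z. \<alpha> c' z (\<lambda>i. D x (w i))) (at (\<tau> x)) (D x h) +
          (\<Sum>l<k. \<alpha> c' (\<tau> x) ((\<lambda>i. D x (w i))(l := Q h (w l)))))) (at x)"
    proof (rule has_derivative_alternating_apply[OF B U])
      show "alternating_map k (\<alpha> c' (\<tau> y))" if "y \<in> U" for y
        using forms_alternating[OF \<alpha> c(2) \<tau>_image[OF that]] .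
      show "((\<lambda>y. \<alpha> c' (\<tau> y) w) has_derivative
          (\<lambda>h. frechet_derivative (\<lambda>z. \<alpha> c' z w) (at (\<tau> x)) (D x h))) (at x)" for w
        using diff_chain_at[OF smooth_on_has_derivative[OF \<tau> U(2)]
            forms_has_derivative[OF \<alpha> c(2) \<tau>_image[OF U(2)]]] by (simp add: o_def D_def)
      show "((\<lambda>y. D y (w i)) has_derivative (\<lambda>h. Q h (w i))) (at x)" for i
        unfolding Q_def D_def by (rule smooth_on_has_derivative[OF smooth_on_frechet_derivative[OF \<tau>] U(2)])
    qed
    from has_derivative_transform_within_open[OF this U pull] show ?thesis
      by (simp add: frechet_derivative_eqI)
  qed
  have omit_D: "omit i (\<lambda>i. D x (v i)) = (\<lambda>l. D x (omit i v l))" for i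
    by (auto simp: omit_def)
  have "(\<Sum>i\<le>k. (- 1) ^ i * (\<Sum>l<k. \<alpha> c' (\<tau> x) ((\<lambda>j. D x (omit i v j))(l := Q (v i) (omit i v l))))) = 0"
    using sum_omit_symmetric_eq0[OF forms_alternating[OF \<alpha> c(2) \<tau>_image[OF U(2)]] Q_sym,
        where w = "\<lambda>i. D x (v i)" and v = v] by (simp add: omit_D)
  then show ?thesis
    using c x \<tau>_image[OF U(2)]
    by (simp add: ext_d_def deriv omit_D distrib_left sum.distrib flip: x_def)
qed

lemma ext_d_forms:
  assumes \<alpha>: "\<alpha> \<in> forms A k"
  shows "ext_d A k \<alpha> \<in> forms A (Suc k)"
proof (rule formsI)
  fix c x assume c: "c \<in> A" "x \<in> chart_image c"
  have "alternating_map (Suc k) (\<lambda>v. \<Sum>i\<le>k. (- 1) ^ i *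
      frechet_derivative (\<lambda>y. \<alpha> c y (omit i v)) (at x) (v i))"
  proof (rule alternating_map_alternating_sum[of k "\<lambda>h w. frechet_derivative (\<lambda>y. \<alpha> c y w) (at x) h"])
    show "alternating_map k (\<lambda>w. frechet_derivative (\<lambda>y. \<alpha> c y w) (at x) h)" for h
      by (rule alternating_map_frechet_derivative[OF manifold_chart_image_open[OF c(1)] c(2)
          forms_alternating[OF \<alpha> c(1)] smooth_on_differentiable[OF forms_smooth[OF \<alpha> c(1)] c(2)]])
    show "linear (\<lambda>h. frechet_derivative (\<lambda>y. \<alpha> c y w) (at x) h)" for w
      using has_derivative_linear[OF forms_has_derivative[OF \<alpha> c]] .
  qed
  then show "alternating_map (Suc k) (ext_d A k \<alpha> c x)"
    using c by (simp add: ext_d_def)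
next
  fix c v assume c: "c \<in> A"
  show "smooth_on (chart_image c) (\<lambda>x. ext_d A k \<alpha> c x v)"
  proof (rule smooth_on_cong[OF manifold_chart_image_open[OF c]])
    show "(\<Sum>i\<le>k. (- 1) ^ i * frechet_derivative (\<lambda>y. \<alpha> c y (omit i v)) (at x) (v i)) = ext_d A k \<alpha> c x v"
      if "x \<in> chart_image c" for x using c that by (simp add: ext_d_def)
    show "smooth_on (chart_image c)
        (\<lambda>x. \<Sum>i\<le>k. (- 1) ^ i * frechet_derivative (\<lambda>y. \<alpha> c y (omit i v)) (at x) (v i))"
      using c forms_smooth[OF \<alpha> c]
      by (intro smooth_on_sum smooth_on_mult smooth_on_const smooth_on_frechet_derivative
          manifold_chart_image_open)
  qed
next
  fix c c' p v assume c: "c \<in> A" "c' \<in> A" "p \<in> fst c" "p \<in> fst c'"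
  show "ext_d A k \<alpha> c (snd c p) v = ext_d A k \<alpha> c' (snd c' p) (\<lambda>i. dtransition c c' p (v i))"
    by (rule ext_d_transition[OF \<alpha> c])
next
  fix c x assume "\<not> (c \<in> A \<and> x \<in> chart_image c)"
  then show "ext_d A k \<alpha> c x = 0"
    unfolding ext_d_def by (simp only: if_False zero_fun_def)
qed

lemma ext_d_add:
  assumes \<alpha>: "\<alpha> \<in> forms A k" and \<beta>: "\<beta> \<in> forms A k"
  shows "ext_d A k (\<alpha> + \<beta>) = ext_d A k \<alpha> + ext_d A k \<beta>"
proof -
  have "frechet_derivative (\<lambda>y. \<alpha> c y w + \<beta> c y w) (at x) =
      (\<lambda>h. frechet_derivative (\<lambda>y. \<alpha> c y w) (at x) h + frechet_derivative (\<lambda>y. \<beta> c y w) (at x) h)"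
    if "c \<in> A" "x \<in> chart_image c" for c x w
    by (rule frechet_derivative_eqI[OF has_derivative_add[OF forms_has_derivative[OF \<alpha> that]
          forms_has_derivative[OF \<beta> that]]])
  then show ?thesis
    by (auto simp: ext_d_def fun_eq_iff distrib_left sum.distrib)
qed

lemma ext_d_scale:
  assumes \<alpha>: "\<alpha> \<in> forms A k"
  shows "ext_d A k (scale_form z \<alpha>) = scale_form z (ext_d A k \<alpha>)"
proof -
  have "frechet_derivative (\<lambda>y. z * \<alpha> c y w) (at x) =
      (\<lambda>h. z * frechet_derivative (\<lambda>y. \<alpha> c y w) (at x) h)"
    if "c \<in> A" "x \<in> chart_image c" for c x w
    by (rule frechet_derivative_eqI[OF has_derivative_mult_right[OF forms_has_derivative[OF \<alpha> that]]])
  then show ?thesis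
    by (auto simp: ext_d_def scale_form_def fun_eq_iff sum_distrib_left mult_ac)
qed

end

section \<open>Bidegree of alternating maps\<close>

lemma alternating_map_permute:
  assumes f: "alternating_map k f" and \<sigma>: "\<sigma> permutes {..<k}"
  shows "f (v \<circ> \<sigma>) = of_int (sign \<sigma>) * f v"
proof -
  have "\<forall>v. f (v \<circ> \<sigma>) = of_int (sign \<sigma>) * f v"
    using \<sigma> finite_lessThan[of k]
  proof (induction rule: permutes_induct)
    case (swap a b p)
    have "permutation p" using swap permutation_permutes by blast
    then have s: "sign (Transposition.transpose a b \<circ> p) = - sign p"
      using swap by (simp add: sign_compose permutation_swap_id sign_swap_id)
    show ?case
    proof
      fix v :: "nat \<Rightarrow> 'a"
      have "f (v \<circ> (Transposition.transpose a b \<circ> p)) = of_int (sign p) * f (v \<circ> Transposition.transpose a b)"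
        using swap.IH[rule_format, of "v \<circ> Transposition.transpose a b"] by (simp only: comp_assoc)
      also have "v \<circ> Transposition.transpose a b = v(a := v b, b := v a)"
        by (auto simp: fun_eq_iff transpose_def)
      also have "f \<dots> = - f v"
        using swap by (intro alternating_map_swap[OF f]) auto
      finally show "f (v \<circ> (Transposition.transpose a b \<circ> p)) = of_int (sign (Transposition.transpose a b \<circ> p)) * f v"
        unfolding s by (simp only: of_int_minus mult_minus_left mult_minus_right)
    qed
  qed auto
  then show ?thesis by blast
qed

text \<open>Antisymmetrising leaves an alternating map unchanged, and it turns products of covectors
  into wedges.\<close>

lemma alternating_map_average:
  assumes f: "alternating_map k f"
  shows "f v = (\<Sum>\<sigma> | \<sigma> permutes {..<k}. of_int (sign \<sigma>) * f (v \<circ> \<sigma>)) / fact k"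
proof -
  have "of_int (sign \<sigma>) * f (v \<circ> \<sigma>) = f v" if "\<sigma> permutes {..<k}" for \<sigma>
    by (simp add: alternating_map_permute[OF f that] sign_idempotent flip: mult.assoc of_int_mult)
  then have "(\<Sum>\<sigma> | \<sigma> permutes {..<k}. of_int (sign \<sigma>) * f (v \<circ> \<sigma>)) = fact k * f v"
    using card_permutations[of "{..<k}" k] by simp
  then show ?thesis by simp
qed

lemma wedge_permute:
  assumes \<rho>: "\<rho> permutes {..<k}"
  shows "wedge k (\<theta> \<circ> \<rho>) v = of_int (sign \<rho>) * wedge k \<theta> v"
proof -
  define F where "F \<sigma> = of_int (sign \<sigma>) * (\<Prod>j<k. \<theta> (\<rho> j) (v (\<sigma> j)))" for \<sigma>
  have "F (\<sigma> \<circ> \<rho>) = of_int (sign \<rho>) * (of_int (sign \<sigma>) * (\<Prod>j<k. \<theta> j (v (\<sigma> j))))"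
    if "\<sigma> permutes {..<k}" for \<sigma>
  proof -
    have "sign (\<sigma> \<circ> \<rho>) = sign \<sigma> * sign \<rho>"
      using that \<rho> by (intro sign_compose) (auto simp: permutation_permutes)
    moreover have "(\<Prod>j<k. \<theta> j (v (\<sigma> j))) = (\<Prod>j<k. \<theta> (\<rho> j) (v ((\<sigma> \<circ> \<rho>) j)))"
      using prod.permute[OF \<rho>, of "\<lambda>j. \<theta> j (v (\<sigma> j))"] by (simp add: o_def)
    ultimately show ?thesis by (simp add: F_def mult_ac)
  qed
  then have "(\<Sum>\<sigma> | \<sigma> permutes {..<k}. F (\<sigma> \<circ> \<rho>)) = of_int (sign \<rho>) * wedge k \<theta> v"
    by (simp add: wedge_def sum_distrib_left)
  then show ?thesis
    using sum_permutations_compose_right[OF \<rho>, of F] by (simp add: wedge_def F_def)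
qed

text \<open>A bijection of the first \<open>card S\<close> indices with \<open>S\<close> is glued to
  one between the complements. It serves to bring the factors indexed by \<open>S\<close> to the
  front of a wedge.\<close>

lemma exists_permutes_image:
  assumes "S \<subseteq> {..<k}"
  shows "\<exists>\<rho>. \<rho> permutes {..<k} \<and> \<rho> ` {..<card S} = S"
proof -
  have fin: "finite S" using assms finite_subset by blast
  have le: "card S \<le> k" using card_mono[OF _ assms] by simp
  obtain f where f: "bij_betw f {..<card S} S"
    using fin ex_bij_betw_nat_finite[of S] by (auto simp: atLeast0LessThan)
  have "card {card S..<k} = card ({..<k} - S)"
    using assms fin by (simp add: card_Diff_subset)
  then obtain g where g: "bij_betw g {card S..<k} ({..<k} - S)"
    by (meson finite_atLeastLessThan finite_Diff finite_lessThan finite_same_card_bij)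
  define \<rho> where "\<rho> j = (if j < card S then f j else if j < k then g j else j)" for j
  have 1: "bij_betw \<rho> {..<card S} S"
    using f by (subst bij_betw_cong[of _ _ f]) (auto simp: \<rho>_def)
  have 2: "bij_betw \<rho> {card S..<k} ({..<k} - S)"
    using g by (subst bij_betw_cong[of _ _ g]) (auto simp: \<rho>_def)
  have "{..<card S} \<union> {card S..<k} = {..<k}" "S \<union> ({..<k} - S) = {..<k}"
    using le assms by auto
  then have "bij_betw \<rho> {..<k} {..<k}"
    using bij_betw_combine[OF 1 2] by auto
  then have "\<rho> permutes {..<k}"
    by (rule bij_imp_permutes) (use le in \<open>auto simp: \<rho>_def\<close>)
  then show ?thesis using 1 bij_betw_imp_surj_on by blast
qed

section \<open>Rotations and types of covectors\<close>

text \<open>For \<open>I\<close> with square -1 this is exp(tI), an action of the circle; at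
  \<open>t = pi / 2\<close> it is \<open>I\<close> itself.\<close>

definition cplx_rotate :: "real \<Rightarrow> ('e::real_vector \<Rightarrow> 'e) \<Rightarrow> 'e \<Rightarrow> 'e" where
  "cplx_rotate t I v = cos t *\<^sub>R v + sin t *\<^sub>R I v"

lemma cis_eq: "cis t = of_real (cos t) + \<i> * of_real (sin t)"
  by (simp add: complex_eq_iff)

lemma covectors_10_rotate: "\<theta> \<in> covectors_10 I \<Longrightarrow> \<theta> (cplx_rotate t I v) = cis t * \<theta> v"
  by (simp add: covectors_10_def cplx_rotate_def linear_add linear_cmul cis_eq scaleR_conv_of_real algebra_simps)

lemma covectors_01_rotate: "\<theta> \<in> covectors_01 I \<Longrightarrow> \<theta> (cplx_rotate t I v) = cis (- t) * \<theta> v"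
  by (simp add: covectors_01_def cplx_rotate_def linear_add linear_cmul cis_eq scaleR_conv_of_real algebra_simps)

text \<open>A factor of type (1,0) contributes \<open>cis t\<close>, one of type (0,1) contributes
  \<open>cis (- t)\<close>, so the weight is \<open>card S - (k - card S)\<close>. The set
  \<open>S\<close> is arbitrary because \<open>alternating_map_wedge_expansion\<close> delivers the
  factors unsorted.\<close>

lemma wedge_rotate:
  assumes S: "S \<subseteq> {..<k}" and 10: "\<And>i. i \<in> S \<Longrightarrow> \<theta> i \<in> covectors_10 I"
    and 01: "\<And>i. i \<in> {..<k} - S \<Longrightarrow> \<theta> i \<in> covectors_01 I"
  shows "wedge k \<theta> (\<lambda>i. cplx_rotate t I (v i)) = cis (t * (2 * real (card S) - real k)) * wedge k \<theta> v"
proof -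
  have fin: "finite S" using S finite_subset by blast
  have le: "card S \<le> k" using card_mono[OF _ S] by simp
  have c: "card ({..<k} - S) = k - card S" using S fin by (simp add: card_Diff_subset)
  have "(\<Prod>j<k. \<theta> j (cplx_rotate t I (v (\<sigma> j)))) = cis (t * (2 * real (card S) - real k)) * (\<Prod>j<k. \<theta> j (v (\<sigma> j)))" for \<sigma>
  proof -
    have "(\<Prod>j<k. \<theta> j (cplx_rotate t I (v (\<sigma> j)))) = (\<Prod>j<k. (if j \<in> S then cis t else cis (- t)) * \<theta> j (v (\<sigma> j)))"
      using covectors_10_rotate[OF 10] covectors_01_rotate[OF 01] by (intro prod.cong) auto
    also have "\<dots> = (\<Prod>j<k. if j \<in> S then cis t else cis (- t)) * (\<Prod>j<k. \<theta> j (v (\<sigma> j)))"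
      by (rule prod.distrib)
    also have "(\<Prod>j<k. if j \<in> S then cis t else cis (- t)) = cis t ^ card S * cis (- t) ^ (k - card S)"
      using S by (simp add: prod.If_cases Int_absorb1 c Diff_eq[symmetric])
    also have "\<dots> = cis (t * (2 * real (card S) - real k))"
      unfolding Complex.DeMoivre cis_mult using le by (simp add: of_nat_diff algebra_simps)
    finally show ?thesis .
  qed
  then show ?thesis by (simp add: wedge_def sum_distrib_left mult_ac)
qed

lemma pq_covectors_rotate:
  assumes "f \<in> pq_covectors p q I"
  shows "f (\<lambda>i. cplx_rotate t I (v i)) = cis (t * (real p - real q)) * f v"
proof -
  obtain N :: nat and z \<theta> where f: "f = (\<lambda>v. \<Sum>n<N. z n * wedge (p + q) (\<theta> n) v)"
    and \<theta>: "\<And>n. n < N \<Longrightarrow> (\<forall>j<p. \<theta> n j \<in> covectors_10 I) \<and> (\<forall>j\<in>{p..<p + q}. \<theta> n j \<in> covectors_01 I)"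
    using assms unfolding pq_covectors_def by blast
  have "wedge (p + q) (\<theta> n) (\<lambda>i. cplx_rotate t I (v i)) = cis (t * (real p - real q)) * wedge (p + q) (\<theta> n) v"
    if "n < N" for n
    using wedge_rotate[of "{..<p}" "p + q" "\<theta> n" I t v] \<theta>[OF that] by auto
  then show ?thesis by (simp add: f sum_distrib_left mult_ac)
qed

lemma pq_covectors_sumI:
  assumes S: "finite S"
    and \<theta>: "\<And>s. s \<in> S \<Longrightarrow> (\<forall>j<p. \<theta> s j \<in> covectors_10 I) \<and> (\<forall>j\<in>{p..<p + q}. \<theta> s j \<in> covectors_01 I)"
  shows "(\<lambda>v. \<Sum>s\<in>S. z s * wedge (p + q) (\<theta> s) v) \<in> pq_covectors p q I"
proof -
  obtain h where h: "bij_betw h {..<card S} S"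
    using ex_bij_betw_nat_finite[OF S] by (auto simp: atLeast0LessThan)
  have "(\<Sum>s\<in>S. z s * wedge (p + q) (\<theta> s) v) = (\<Sum>n<card S. z (h n) * wedge (p + q) (\<theta> (h n)) v)" for v
    using sum.reindex_bij_betw[OF h, of "\<lambda>s. z s * wedge (p + q) (\<theta> s) v"] by simp
  moreover have "h n \<in> S" if "n < card S" for n
    using h that bij_betwE by blast
  ultimately show ?thesis
    unfolding pq_covectors_def using \<theta>
    by (intro CollectI exI[of _ "card S"] exI[of _ "z \<circ> h"] exI[of _ "\<theta> \<circ> h"]) auto
qed

text \<open>\<open>pq_covectors\<close> wants the (1,0)-factors first; sorting costs only the sign
  of a permutation.\<close>

lemma wedge_sort:
  assumes S: "S \<subseteq> {..<k}" and 10: "\<And>i. i \<in> S \<Longrightarrow> \<theta> i \<in> covectors_10 I"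
    and 01: "\<And>i. i \<in> {..<k} - S \<Longrightarrow> \<theta> i \<in> covectors_01 I"
  shows "\<exists>c \<theta>'. (\<forall>v. wedge k \<theta> v = c * wedge k \<theta>' v) \<and>
    (\<forall>j<card S. \<theta>' j \<in> covectors_10 I) \<and> (\<forall>j\<in>{card S..<k}. \<theta>' j \<in> covectors_01 I)"
proof -
  obtain \<rho> where \<rho>: "\<rho> permutes {..<k}" "\<rho> ` {..<card S} = S"
    using exists_permutes_image[OF S] by blast
  have "wedge k \<theta> v = of_int (sign \<rho>) * wedge k (\<theta> \<circ> \<rho>) v" for v
    by (simp add: wedge_permute[OF \<rho>(1)] sign_idempotent flip: mult.assoc of_int_mult)
  moreover have "\<rho> j \<in> S" if "j < card S" for j using \<rho>(2) that by blast
  moreover have "\<rho> j \<in> {..<k} - S" if "j \<in> {card S..<k}" for j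
  proof -
    have "\<rho> j \<notin> \<rho> ` {..<card S}"
      using that inj_image_mem_iff[OF permutes_inj[OF \<rho>(1)]] by simp
    moreover have "\<rho> j \<in> {..<k}" using that permutes_in_image[OF \<rho>(1)] by auto
    ultimately show ?thesis using \<rho>(2) by auto
  qed
  ultimately show ?thesis
    using 10 01 by (intro exI[of _ "of_int (sign \<rho>)"] exI[of _ "\<theta> \<circ> \<rho>"]) auto
qed

text \<open>Each real coordinate is the sum of a (1,0)- and a (0,1)-covector. Expanding all
  arguments accordingly gives products of covectors of known type, and averaging over permutations
  turns these into wedges.\<close>

lemma alternating_map_wedge_expansion:
  fixes f :: "(nat \<Rightarrow> 'e::real_inner) \<Rightarrow> complex" and B :: "'e set"
  assumes B: "orthogonal_frame B" and I: "linear I" "\<And>v. I (I v) = - v"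
    and f: "alternating_map k f"
  obtains P :: "(nat \<Rightarrow> 'e \<times> bool) set" and z \<theta> S where "finite P"
    "\<And>j. j \<in> P \<Longrightarrow> S j \<subseteq> {..<k}"
    "\<And>j i. j \<in> P \<Longrightarrow> i \<in> S j \<Longrightarrow> \<theta> j i \<in> covectors_10 I"
    "\<And>j i. j \<in> P \<Longrightarrow> i \<in> {..<k} - S j \<Longrightarrow> \<theta> j i \<in> covectors_01 I"
    "\<And>v. f v = (\<Sum>j\<in>P. z j * wedge k (\<theta> j) v)"
proof -
  define \<Lambda> where "\<Lambda> = B \<times> (UNIV :: bool set)"
  \<comment> \<open>The parts of \<open>coord b\<close> of type (1,0), for \<open>s\<close> true,
    and of type (0,1), for \<open>s\<close> false; their sum is \<open>coord b\<close>.\<close>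
  define \<phi> where "\<phi> = (\<lambda>(b, s) v. (coord b v + (if s then - \<i> else \<i>) * coord b (I v)) / 2)"
  have lin: "linear (coord b)" for b :: 'e
    by (rule bounded_linear.linear[OF bounded_linear_coord])
  have \<phi>_linear: "linear (\<phi> l)" for l
    using lin linear_compose[OF I(1) lin]
    by (cases l) (auto simp: \<phi>_def linear_iff scaleR_conv_of_real field_simps)
  have \<phi>_type: "\<phi> (b, True) \<in> covectors_10 I" "\<phi> (b, False) \<in> covectors_01 I" for b
    using \<phi>_linear[of "(b, True)"] \<phi>_linear[of "(b, False)"]
    by (auto simp: covectors_10_def covectors_01_def \<phi>_def I(2) linear_neg[OF lin] field_simps)
  have fin: "finite \<Lambda>" using B by (simp add: \<Lambda>_def orthogonal_frame_def)
  have frame: "g v = (\<Sum>l\<in>\<Lambda>. \<phi> l v * g (fst l))" if "linear g" for g v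
  proof -
    have "(\<Sum>l\<in>\<Lambda>. \<phi> l v * g (fst l)) = (\<Sum>b\<in>B. \<Sum>s\<in>UNIV. \<phi> (b, s) v * g b)"
      by (simp add: \<Lambda>_def sum.cartesian_product case_prod_unfold)
    also have "\<dots> = (\<Sum>b\<in>B. coord b v * g b)"
      by (intro sum.cong refl) (simp add: UNIV_bool \<phi>_def field_simps)
    finally show ?thesis by (rule trans[OF orthogonal_frame_expand[OF B that] sym])
  qed
  define P where "P = Pi\<^sub>E {..<k} (\<lambda>_. \<Lambda>)"
  show thesis
  \<comment> \<open>A choice \<open>j\<close> assigns to each argument a frame vector and a type;
    the denominator \<open>fact k\<close> comes from the averaging.\<close>
  proof (rule that[of P "\<lambda>j. {i. i < k \<and> snd (j i)}" "\<lambda>j i. \<phi> (j i)" "\<lambda>j. f (\<lambda>i. fst (j i)) / fact k"])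
    show "finite P" using fin by (simp add: P_def finite_PiE)
    show "\<phi> (j i) \<in> covectors_10 I" if "i \<in> {i. i < k \<and> snd (j i)}" for j i
      using that \<phi>_type(1)[of "fst (j i)"] by (cases "j i") auto
    show "\<phi> (j i) \<in> covectors_01 I" if "i \<in> {..<k} - {i. i < k \<and> snd (j i)}" for j i
      using that \<phi>_type(2)[of "fst (j i)"] by (cases "j i") auto
    show "f v = (\<Sum>j\<in>P. f (\<lambda>i. fst (j i)) / fact k * wedge k (\<lambda>i. \<phi> (j i)) v)" for v
    proof -
      have "f (v \<circ> \<sigma>) = (\<Sum>j\<in>P. (\<Prod>i<k. \<phi> (j i) (v (\<sigma> i))) * f (\<lambda>i. fst (j i)))" for \<sigma>
        unfolding P_def using multilinear_expansion[OF f fin frame, of "v \<circ> \<sigma>"] by (simp only: o_apply)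
      then have "(\<Sum>\<sigma> | \<sigma> permutes {..<k}. of_int (sign \<sigma>) * f (v \<circ> \<sigma>)) =
        (\<Sum>\<sigma> | \<sigma> permutes {..<k}. \<Sum>j\<in>P. of_int (sign \<sigma>) * ((\<Prod>i<k. \<phi> (j i) (v (\<sigma> i))) * f (\<lambda>i. fst (j i))))"
        by (simp only: sum_distrib_left)
      also have "\<dots> = (\<Sum>j\<in>P. f (\<lambda>i. fst (j i)) * wedge k (\<lambda>i. \<phi> (j i)) v)"
        by (subst sum.swap) (simp add: wedge_def sum_distrib_left mult_ac)
      finally show ?thesis
        by (subst alternating_map_average[OF f]) (simp add: sum_divide_distrib)
    qed
  qed auto
qed

section \<open>Projection to one bidegree\<close>

text \<open>Orthogonality of characters: the summand is the \<open>r\<close>-th power of a (k+1)-st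
  root of unity \<open>w\<close>, which is 1 only for \<open>m = p\<close>.\<close>

lemma sum_cis_roots:
  fixes k m p :: nat
  assumes "m \<le> k" "p \<le> k"
  shows "(\<Sum>r\<le>k. cis (pi * real r / real (Suc k) * (real k - 2 * real p)) *
      cis (pi * real r / real (Suc k) * (2 * real m - real k))) = (if m = p then of_nat (Suc k) else 0)"
proof -
  define w where "w = cis (2 * pi * (real m - real p) / real (Suc k))"
  have "cis (pi * real r / real (Suc k) * (real k - 2 * real p)) *
      cis (pi * real r / real (Suc k) * (2 * real m - real k)) = w ^ r" for r
    unfolding w_def Complex.DeMoivre cis_mult
    by (rule arg_cong[of _ _ cis]) (simp add: divide_inverse algebra_simps del: of_nat_Suc)
  then have eq: "(\<Sum>r\<le>k. cis (pi * real r / real (Suc k) * (real k - 2 * real p)) *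
      cis (pi * real r / real (Suc k) * (2 * real m - real k))) = (\<Sum>r<Suc k. w ^ r)"
    by (simp add: lessThan_Suc_atMost)
  show ?thesis
  proof (cases "m = p")
    case True
    then show ?thesis unfolding eq by (simp add: w_def)
  next
    case False
    have "w \<noteq> 1"
    proof
      assume "w = 1"
      then have "cos (2 * pi * (real m - real p) / real (Suc k)) = 1"
        by (simp add: w_def complex_eq_iff)
      then obtain n :: int where "2 * pi * (real m - real p) / real (Suc k) = of_int n * 2 * pi"
        by (auto simp: cos_one_2pi_int)
      then have "(2 * pi) * (real m - real p) = (2 * pi) * (of_int n * real (Suc k))"
        by (simp only: divide_eq_eq of_nat_eq_0_iff nat.simps mult_ac not_False_eq_True if_True)
      then have "real m - real p = of_int n * real (Suc k)"
        by (subst (asm) mult_left_cancel) simp_all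
      then have n: "int m - int p = n * int (Suc k)"
        by (metis of_int_diff of_int_eq_iff of_int_mult of_int_of_nat_eq)
      \<comment> \<open>As \<open>m\<close> and \<open>p\<close> lie between 0 and \<open>k\<close>,
        their difference is too small to be a nonzero multiple of \<open>Suc k\<close>.\<close>
      then have "int (Suc k) dvd int m - int p" by simp
      moreover have "\<bar>int m - int p\<bar> < int (Suc k)" "int m - int p \<noteq> 0" using assms False by auto
      ultimately show False using zdvd_imp_le[of "int (Suc k)" "\<bar>int m - int p\<bar>"] by auto
    qed
    moreover have "w ^ Suc k = 1"
    proof -
      have "w ^ Suc k = cis (2 * pi * of_int (int m - int p))"
        unfolding w_def Complex.DeMoivre by (rule arg_cong[of _ _ cis]) (simp add: field_simps)
      then show ?thesis by (simp only: cis_multiple_2pi[OF Ints_of_int])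
    qed
    ultimately show ?thesis unfolding eq using False geometric_sum[of w "Suc k"] by simp
  qed
qed

text \<open>The \<open>(p, k - p)\<close>-component, written without a choice of basis so that it depends smoothly on
  \<^term>\<open>I\<close>.  The rotation \<open>cos t + sin t I\<close> acts on \<open>(p, k - p)\<close>-covectors with weight
  \<open>2 p - k\<close>, so a discrete Fourier transform isolates one weight; the angles \<open>\<pi> r / (k + 1)\<close> suffice
  because two weights differ by twice an integer of absolute value at most \<open>k\<close>.\<close>

definition pq_projection ::
    "('e::real_vector \<Rightarrow> 'e) \<Rightarrow> nat \<Rightarrow> nat \<Rightarrow> ((nat \<Rightarrow> 'e) \<Rightarrow> complex) \<Rightarrow> (nat \<Rightarrow> 'e) \<Rightarrow> complex" where
  "pq_projection I k p f v = (\<Sum>r\<le>k. cis (pi * real r / real (Suc k) * (real k - 2 * real p)) / of_nat (Suc k) *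
     f (\<lambda>i. cplx_rotate (pi * real r / real (Suc k)) I (v i)))"

text \<open>The projection is defined without a frame, but at a fixed \<open>I\<close> the proof may
  expand \<open>f\<close> in wedges. By \<open>proj\<close> the projection keeps exactly the wedges
  with \<open>p\<close> factors of type (1,0), and both claims follow.\<close>

lemma
  fixes f :: "(nat \<Rightarrow> 'e::real_inner) \<Rightarrow> complex" and B :: "'e set"
  assumes B: "orthogonal_frame B" and I: "linear I" "\<And>v. I (I v) = - v"
    and f: "alternating_map k f"
  shows pq_projection_pq_covectors: "p \<le> k \<Longrightarrow> pq_projection I k p f \<in> pq_covectors p (k - p) I"
    and sum_pq_projection: "(\<Sum>p\<le>k. pq_projection I k p f v) = f v"
proof -
  obtain P :: "(nat \<Rightarrow> 'e \<times> bool) set" and z \<theta> S where P: "finite P"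
    and S: "\<And>j. j \<in> P \<Longrightarrow> S j \<subseteq> {..<k}"
    and 10: "\<And>j i. j \<in> P \<Longrightarrow> i \<in> S j \<Longrightarrow> \<theta> j i \<in> covectors_10 I"
    and 01: "\<And>j i. j \<in> P \<Longrightarrow> i \<in> {..<k} - S j \<Longrightarrow> \<theta> j i \<in> covectors_01 I"
    and f_eq: "\<And>v. f v = (\<Sum>j\<in>P. z j * wedge k (\<theta> j) v)"
    by (rule alternating_map_wedge_expansion[OF B I f]) (rule that)
  have card_le: "card (S j) \<le> k" if "j \<in> P" for j
    using card_mono[OF _ S[OF that]] by simp
  have proj: "pq_projection I k p f v = (\<Sum>j\<in>P. if card (S j) = p then z j * wedge k (\<theta> j) v else 0)"
    if "p \<le> k" for p v
  proof -
    let ?t = "\<lambda>r. pi * real r / real (Suc k)"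
    have "pq_projection I k p f v = (\<Sum>r\<le>k. \<Sum>j\<in>P. (cis (?t r * (real k - 2 * real p)) *
        cis (?t r * (2 * real (card (S j)) - real k))) * (z j * wedge k (\<theta> j) v / of_nat (Suc k)))"
      unfolding pq_projection_def f_eq sum_distrib_left
    proof (intro sum.cong refl)
      fix r j assume "j \<in> P"
      from wedge_rotate[OF S[OF this] 10[OF this] 01[OF this]]
      show "cis (?t r * (real k - 2 * real p)) / of_nat (Suc k) *
          (z j * wedge k (\<theta> j) (\<lambda>i. cplx_rotate (?t r) I (v i))) =
        (cis (?t r * (real k - 2 * real p)) * cis (?t r * (2 * real (card (S j)) - real k))) *
          (z j * wedge k (\<theta> j) v / of_nat (Suc k))"
        by (simp only: times_divide_eq_left times_divide_eq_right mult_ac)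
    qed
    also have "\<dots> = (\<Sum>j\<in>P. (if card (S j) = p then of_nat (Suc k) else 0) *
        (z j * wedge k (\<theta> j) v / of_nat (Suc k)))"
      using sum_cis_roots[OF card_le that]
      by (subst sum.swap) (simp only: flip: sum_distrib_right cong: sum.cong)
    also have "\<dots> = (\<Sum>j\<in>P. if card (S j) = p then z j * wedge k (\<theta> j) v else 0)"
      by (intro sum.cong refl) (simp del: of_nat_Suc)
    finally show ?thesis .
  qed
  show "pq_projection I k p f \<in> pq_covectors p (k - p) I" if p: "p \<le> k"
  proof -
    define P' where "P' = {j \<in> P. card (S j) = p}"
    have "\<forall>j\<in>P'. \<exists>c \<theta>'. (\<forall>v. wedge k (\<theta> j) v = c * wedge k \<theta>' v) \<and>
        (\<forall>i<p. \<theta>' i \<in> covectors_10 I) \<and> (\<forall>i\<in>{p..<k}. \<theta>' i \<in> covectors_01 I)"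
      using wedge_sort[OF S 10 01] by (fastforce simp: P'_def)
    then obtain c \<theta>' where *: "\<And>j v. j \<in> P' \<Longrightarrow> wedge k (\<theta> j) v = c j * wedge k (\<theta>' j) v"
      "\<And>j. j \<in> P' \<Longrightarrow> (\<forall>i<p. \<theta>' j i \<in> covectors_10 I) \<and> (\<forall>i\<in>{p..<k}. \<theta>' j i \<in> covectors_01 I)"
      by metis
    have "pq_projection I k p f v = (\<Sum>j\<in>P'. (z j * c j) * wedge (p + (k - p)) (\<theta>' j) v)" for v
      unfolding proj[OF p] P'_def
      using P p by (simp add: sum.inter_filter[symmetric] *(1)[unfolded P'_def] mult_ac)
    then have "pq_projection I k p f = (\<lambda>v. \<Sum>j\<in>P'. (z j * c j) * wedge (p + (k - p)) (\<theta>' j) v)"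
      by blast
    also have "\<dots> \<in> pq_covectors p (k - p) I"
      using P p *(2) by (intro pq_covectors_sumI) (auto simp: P'_def)
    finally show ?thesis .
  qed
  show "(\<Sum>p\<le>k. pq_projection I k p f v) = f v"
  proof -
    have "(\<Sum>p\<le>k. pq_projection I k p f v) =
        (\<Sum>p\<le>k. \<Sum>j\<in>P. if card (S j) = p then z j * wedge k (\<theta> j) v else 0)"
      by (intro sum.cong refl proj) simp
    also have "\<dots> = (\<Sum>j\<in>P. \<Sum>p\<le>k. if card (S j) = p then z j * wedge k (\<theta> j) v else 0)"
      by (rule sum.swap)
    also have "\<dots> = f v"
      unfolding f_eq using card_le by (intro sum.cong refl) simp
    finally show ?thesis .
  qed
qed

section \<open>Even and odd parts, and the map in cohomology\<close>

lemma sum_form_apply: "(\<Sum>i\<in>I. F i) c x v = (\<Sum>i\<in>I. F i c x v)"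
  for F :: "'i \<Rightarrow> ('a, 'e) form"
  by (induction I rule: infinite_finite_induct) auto

lemma scale_form_add: "scale_form z (\<alpha> + \<beta>) = scale_form z \<alpha> + scale_form z \<beta>"
  by (simp add: scale_form_def fun_eq_iff distrib_left)

lemma scale_form_zero [simp]: "scale_form z 0 = 0"
  by (simp add: scale_form_def fun_eq_iff)

lemma J_form_zero [simp]: "J_form E 0 = 0"
  by (simp add: J_form_def fun_eq_iff)

section \<open>Subspaces of forms and their cosets\<close>

definition form_subspace :: "('a, 'e) form set \<Rightarrow> bool" where
  "form_subspace S \<longleftrightarrow> 0 \<in> S \<and> (\<forall>\<alpha>\<in>S. \<forall>\<beta>\<in>S. \<alpha> + \<beta> \<in> S) \<and> (\<forall>z. \<forall>\<alpha>\<in>S. scale_form z \<alpha> \<in> S)"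

lemma form_subspace_zero: "form_subspace {0}"
  by (simp add: form_subspace_def)

lemma form_subspace_image:
  assumes S: "form_subspace S"
    and add: "\<And>\<alpha> \<beta>. \<alpha> \<in> S \<Longrightarrow> \<beta> \<in> S \<Longrightarrow> L (\<alpha> + \<beta>) = L \<alpha> + L \<beta>"
    and scale: "\<And>z \<alpha>. \<alpha> \<in> S \<Longrightarrow> L (scale_form z \<alpha>) = scale_form z (L \<alpha>)"
  shows "form_subspace (L ` S)"
proof -
  have 0: "0 \<in> S" using S by (simp add: form_subspace_def)
  have "L 0 = 0" using add[OF 0 0] by simp
  then have "0 \<in> L ` S" using 0 by (metis imageI)
  moreover have "L \<alpha> + L \<beta> \<in> L ` S" if "\<alpha> \<in> S" "\<beta> \<in> S" for \<alpha> \<beta>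
    unfolding add[OF that, symmetric] using S that by (simp add: form_subspace_def)
  moreover have "scale_form z (L \<alpha>) \<in> L ` S" if "\<alpha> \<in> S" for z \<alpha>
    unfolding scale[OF that, symmetric] using S that by (simp add: form_subspace_def)
  ultimately show ?thesis unfolding form_subspace_def by blast
qed

lemma elt_set_plus_eq_image: "a +o S = (+) a ` S"
  by (auto simp: elt_set_plus_def)

text \<open>Holds since \<open>S + R = R\<close>. Taking \<open>S = R\<close> gives sums of cosets,
  a scaled copy of \<open>R\<close> gives their multiples, and the dd^c-exact forms inside the
  d-exact ones give the passage from Bott-Chern to de Rham classes.\<close>

lemma coset_plus_subspace:
  assumes "form_subspace R" "0 \<in> S" "S \<subseteq> R"
  shows "(\<alpha> +o S) + R = \<alpha> +o R"
proof -
  have "S + R = R"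
  proof
    show "S + R \<subseteq> R" using assms by (auto simp: set_plus_def form_subspace_def)
    show "R \<subseteq> S + R" using set_plus_intro[OF assms(2)] by fastforce
  qed
  then show ?thesis by (metis set_plus_rearrange3)
qed

lemma coset_plus_coset:
  assumes "form_subspace S"
  shows "(\<alpha> +o S) + (\<beta> +o S) = (\<alpha> + \<beta>) +o S"
proof -
  have 0: "0 \<in> S" using assms by (simp add: form_subspace_def)
  have "S + S = S"
    using coset_plus_subspace[OF assms 0 subset_refl, of 0] by (simp add: set_zero_plus)
  then show ?thesis by (simp add: set_plus_rearrange)
qed

lemma scale_coset_coset:
  assumes "form_subspace S"
  shows "scale_coset S z (\<alpha> +o S) = scale_form z \<alpha> +o S"
proof -
  have "scale_form z ` (\<alpha> +o S) = scale_form z \<alpha> +o (scale_form z ` S)"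
    by (simp add: elt_set_plus_eq_image image_image scale_form_add)
  moreover have "0 \<in> scale_form z ` S" "scale_form z ` S \<subseteq> S"
    using assms by (auto simp: form_subspace_def image_iff intro: bexI[of _ 0])
  ultimately show ?thesis
    using coset_plus_subspace[OF assms] by (simp add: scale_coset_def)
qed

definition pq_part :: "('a, 'e::real_vector) endo_field \<Rightarrow> nat \<Rightarrow> nat \<Rightarrow> ('a, 'e) form \<Rightarrow> ('a, 'e) form" where
  "pq_part J k p \<alpha> = (\<lambda>c x. pq_projection (J c x) k p (\<alpha> c x))"

context
  fixes m :: nat and X :: "'a topology" and A :: "('a, 'e::real_inner) chart set"
    and J :: "('a, 'e) endo_field"
  assumes AC: "almost_complex_manifold m X A J"
begin

lemma acm_manifold: "smooth_manifold (2 * m) X A"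
  and acm_endo_field: "smooth_endo_field A J"
  and acm_square: "c \<in> A \<Longrightarrow> x \<in> chart_image c \<Longrightarrow> J c x (J c x v) = - v"
  using AC unfolding almost_complex_manifold_def by blast+

lemmas acm_forms_zero = forms_zero[OF acm_manifold]
lemmas acm_forms_add = forms_add[OF acm_manifold]
lemmas acm_forms_scale = forms_scale[OF acm_manifold]
lemmas acm_J_form_forms = J_form_forms[OF acm_manifold]
lemmas acm_ext_d_forms = ext_d_forms[OF acm_manifold]
lemmas acm_ext_d_add = ext_d_add[OF acm_manifold]
lemmas acm_ext_d_scale = ext_d_scale[OF acm_manifold]

lemma form_subspace_forms: "form_subspace (forms A k)"
  by (simp add: form_subspace_def acm_forms_zero acm_forms_add acm_forms_scale)

lemma forms_sum: "(\<And>i. i \<in> I \<Longrightarrow> F i \<in> forms A k) \<Longrightarrow> (\<Sum>i\<in>I. F i) \<in> forms A k"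
  by (induction I rule: infinite_finite_induct) (auto intro: acm_forms_zero acm_forms_add)

lemma smooth_endo_field_minus: "smooth_endo_field A (\<lambda>c x v. - J c x v)"
  using smooth_endo_field_lincomb[OF acm_manifold acm_endo_field, of 0 "- 1"] by simp

text \<open>Pull-back reverses composition, so the hypothesis concerns \<open>E\<close> after
  \<open>F\<close>. Where coordinate expressions have no meaning, both sides are 0.\<close>

lemma J_form_inverse:
  assumes \<beta>: "\<beta> \<in> forms A k"
    and EF: "\<And>c x v. c \<in> A \<Longrightarrow> x \<in> chart_image c \<Longrightarrow> E c x (F c x v) = v"
  shows "J_form F (J_form E \<beta>) = \<beta>"
proof (intro ext)
  fix c x v
  show "J_form F (J_form E \<beta>) c x v = \<beta> c x v"
    using EF forms_outside[OF \<beta>, of c x] by (cases "c \<in> A \<and> x \<in> chart_image c") (auto simp: J_form_def)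
qed

lemma J_form_neg_J_form:
  assumes "\<beta> \<in> forms A k"
  shows "J_form (\<lambda>c x v. - J c x v) (J_form J \<beta>) = \<beta>"
    and "J_form J (J_form (\<lambda>c x v. - J c x v) \<beta>) = \<beta>"
proof -
  show "J_form J (J_form (\<lambda>c x v. - J c x v) \<beta>) = \<beta>"
    by (rule J_form_inverse[OF assms]) (simp add: acm_square)
  have "J c x (- J c x v) = v" if "c \<in> A" "x \<in> chart_image c" for c x v
    using linear_neg[OF endo_field_linear[OF acm_endo_field that]] acm_square[OF that] by simp
  then show "J_form (\<lambda>c x v. - J c x v) (J_form J \<beta>) = \<beta>"
    by (rule J_form_inverse[OF assms])
qed

section \<open>The operator d^c and the subspaces it defines\<close>

text \<open>Here \<open>inv_into\<close> is a true inverse: J is a bijection of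
  \<open>forms A (Suc k)\<close>, inverted by the pull-back under \<open>- J\<close>, and dJ\<alpha>
  lies in that space.\<close>

lemma ext_dc_eq:
  assumes \<alpha>: "\<alpha> \<in> forms A k"
  shows "ext_dc A J k \<alpha> = J_form (\<lambda>c x v. - J c x v) (ext_d A k (J_form J \<alpha>))"
  unfolding ext_dc_def
proof (rule inv_into_f_eq)
  have d: "ext_d A k (J_form J \<alpha>) \<in> forms A (Suc k)"
    by (rule acm_ext_d_forms[OF acm_J_form_forms[OF acm_endo_field \<alpha>]])
  show "inj_on (J_form J) (forms A (Suc k))"
    by (rule inj_on_inverseI) (rule J_form_neg_J_form(1))
  show "J_form (\<lambda>c x v. - J c x v) (ext_d A k (J_form J \<alpha>)) \<in> forms A (Suc k)"
    by (rule acm_J_form_forms[OF smooth_endo_field_minus d])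
  show "J_form J (J_form (\<lambda>c x v. - J c x v) (ext_d A k (J_form J \<alpha>))) = ext_d A k (J_form J \<alpha>)"
    by (rule J_form_neg_J_form(2)[OF d])
qed

lemma ext_dc_forms: "\<alpha> \<in> forms A k \<Longrightarrow> ext_dc A J k \<alpha> \<in> forms A (Suc k)"
  by (simp add: ext_dc_eq acm_J_form_forms acm_ext_d_forms acm_endo_field smooth_endo_field_minus)

lemma ext_dc_add:
  assumes "\<alpha> \<in> forms A k" "\<beta> \<in> forms A k"
  shows "ext_dc A J k (\<alpha> + \<beta>) = ext_dc A J k \<alpha> + ext_dc A J k \<beta>"
  using assms by (simp add: ext_dc_eq acm_forms_add J_form_add acm_ext_d_add acm_J_form_forms acm_endo_field)

lemma ext_dc_scale:
  assumes "\<alpha> \<in> forms A k"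
  shows "ext_dc A J k (scale_form z \<alpha>) = scale_form z (ext_dc A J k \<alpha>)"
  using assms by (simp add: ext_dc_eq acm_forms_scale J_form_scale acm_ext_d_scale acm_J_form_forms acm_endo_field)

lemma ext_dc_eq_0_iff:
  assumes \<alpha>: "\<alpha> \<in> forms A k"
  shows "ext_dc A J k \<alpha> = 0 \<longleftrightarrow> ext_d A k (J_form J \<alpha>) = 0"
proof
  have d: "ext_d A k (J_form J \<alpha>) \<in> forms A (Suc k)"
    by (rule acm_ext_d_forms[OF acm_J_form_forms[OF acm_endo_field \<alpha>]])
  assume "ext_dc A J k \<alpha> = 0"
  then show "ext_d A k (J_form J \<alpha>) = 0"
    using J_form_neg_J_form(2)[OF d] by (simp add: ext_dc_eq[OF \<alpha>])
qed (simp add: ext_dc_eq[OF \<alpha>])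

lemma form_subspace_B_forms: "form_subspace (B_forms A J k)"
  unfolding form_subspace_def
proof (intro conjI ballI allI)
  have "ext_d A k 0 = 0" for k
    using acm_ext_d_add[OF acm_forms_zero acm_forms_zero, of k] by simp
  moreover have "ext_dc A J k 0 = 0" for k
    using ext_dc_add[OF acm_forms_zero acm_forms_zero, of k] by simp
  ultimately show "0 \<in> B_forms A J k"
    by (simp add: B_forms_def acm_forms_zero)
next
  fix \<alpha> \<beta> assume "\<alpha> \<in> B_forms A J k" "\<beta> \<in> B_forms A J k"
  then have f: "\<alpha> \<in> forms A k" "\<beta> \<in> forms A k"
    and "(ext_d A (Suc k) (ext_dc A J k \<alpha>) + ext_dc A J (Suc k) (ext_d A k \<alpha>)) +
      (ext_d A (Suc k) (ext_dc A J k \<beta>) + ext_dc A J (Suc k) (ext_d A k \<beta>)) = 0"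
    unfolding B_forms_def by auto
  then show "\<alpha> + \<beta> \<in> B_forms A J k"
    by (simp add: B_forms_def acm_forms_add ext_dc_add acm_ext_d_add acm_ext_d_forms ext_dc_forms algebra_simps)
next
  fix z \<alpha> assume "\<alpha> \<in> B_forms A J k"
  then have f: "\<alpha> \<in> forms A k"
    and "ext_d A (Suc k) (ext_dc A J k \<alpha>) + ext_dc A J (Suc k) (ext_d A k \<alpha>) = 0"
    unfolding B_forms_def by auto
  then have "scale_form z (ext_d A (Suc k) (ext_dc A J k \<alpha>) + ext_dc A J (Suc k) (ext_d A k \<alpha>)) = 0"
    by simp
  with f show "scale_form z \<alpha> \<in> B_forms A J k"
    by (simp add: B_forms_def acm_forms_scale ext_dc_scale acm_ext_d_scale acm_ext_d_forms ext_dc_forms scale_form_add)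
qed

lemma B_forms_subset: "B_forms A J k \<subseteq> forms A k"
  by (auto simp: B_forms_def)

lemma form_subspace_BC_exact: "form_subspace (BC_exact A J k)"
proof (cases "k < 2")
  case False
  then have k: "k - 1 = Suc (k - 2)" by simp
  have "form_subspace ((\<lambda>\<beta>. ext_d A (k - 1) (ext_dc A J (k - 2) \<beta>)) ` B_forms A J (k - 2))"
    unfolding k using subsetD[OF B_forms_subset]
    by (intro form_subspace_image[OF form_subspace_B_forms])
       (simp_all add: ext_dc_add acm_ext_d_add ext_dc_scale acm_ext_d_scale ext_dc_forms)
  with False show ?thesis by (simp add: BC_exact_def)
qed (simp add: BC_exact_def form_subspace_zero)

lemma form_subspace_dR_exact: "form_subspace (dR_exact A k)"
  unfolding dR_exact_def
  by (auto intro!: form_subspace_zero form_subspace_image[OF form_subspace_forms] acm_ext_d_add acm_ext_d_scale)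

lemma BC_exact_subset_dR_exact: "BC_exact A J k \<subseteq> dR_exact A k"
proof (cases "k < 2")
  case True
  then show ?thesis
    using form_subspace_dR_exact[of k] by (simp add: BC_exact_def form_subspace_def)
next
  case False
  \<comment> \<open>Subtraction is truncated, so the first equation holds only from degree 2 on;
    below that \<open>BC_exact\<close> is \<open>{0}\<close>.\<close>
  then have k: "k - 1 = Suc (k - 2)" "k \<noteq> 0" by simp_all
  have "ext_dc A J (k - 2) \<beta> \<in> forms A (k - 1)" if "\<beta> \<in> B_forms A J (k - 2)" for \<beta>
    unfolding k(1) using that B_forms_subset by (intro ext_dc_forms) blast
  then show ?thesis using False k(2) by (auto simp: BC_exact_def dR_exact_def)
qed

lemma form_subspace_BC_closed: "form_subspace (BC_closed A J k)"
proof -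
  have "ext_d A k 0 = 0"
    using acm_ext_d_add[OF acm_forms_zero acm_forms_zero, of k] by simp
  moreover have "ext_dc A J k 0 = 0"
    using ext_dc_add[OF acm_forms_zero acm_forms_zero, of k] by simp
  ultimately show ?thesis
    using form_subspace_B_forms[of k] subsetD[OF B_forms_subset[of k]]
    unfolding form_subspace_def BC_closed_def
    by (simp add: acm_ext_d_add ext_dc_add acm_ext_d_scale ext_dc_scale)
qed

section \<open>Components and parts of a form\<close>

text \<open>As a linear combination of pull-backs under smooth endomorphism fields, the component is
  smooth and obeys the transformation law without further computation.\<close>

lemma pq_part_eq:
  "pq_part J k p \<alpha> = (\<Sum>r\<le>k. scale_form (cis (pi * real r / real (Suc k) * (real k - 2 * real p)) / of_nat (Suc k))
     (J_form (\<lambda>c x. cplx_rotate (pi * real r / real (Suc k)) (J c x)) \<alpha>))"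
  by (intro ext, simp only: pq_part_def pq_projection_def sum_form_apply scale_form_def J_form_def)

lemma pq_part_pq_forms:
  assumes \<alpha>: "\<alpha> \<in> forms A k" and p: "p \<le> k"
  shows "pq_part J k p \<alpha> \<in> pq_forms A J p (k - p)"
proof -
  have "smooth_endo_field A (\<lambda>c x. cplx_rotate t (J c x))" for t
    using smooth_endo_field_lincomb[OF acm_manifold acm_endo_field, of "cos t" "sin t"]
    by (simp add: cplx_rotate_def[abs_def])
  then have "pq_part J k p \<alpha> \<in> forms A k"
    unfolding pq_part_eq by (intro forms_sum acm_forms_scale acm_J_form_forms \<alpha>)
  moreover obtain B :: "'e set" where B: "orthogonal_frame B"
    by (rule manifold_orthogonal_frame[OF acm_manifold])
  have "pq_part J k p \<alpha> c x \<in> pq_covectors p (k - p) (J c x)" if "c \<in> A" "x \<in> chart_image c" for c x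
    unfolding pq_part_def
    by (rule pq_projection_pq_covectors[OF B endo_field_linear[OF acm_endo_field that]
          acm_square[OF that] forms_alternating[OF \<alpha> that] p])
  ultimately show ?thesis using p by (simp add: pq_forms_def)
qed

lemma sum_pq_part:
  assumes \<alpha>: "\<alpha> \<in> forms A k"
  shows "(\<Sum>p\<le>k. pq_part J k p \<alpha>) = \<alpha>"
proof (intro ext)
  fix c x v
  obtain B :: "'e set" where B: "orthogonal_frame B"
    by (rule manifold_orthogonal_frame[OF acm_manifold])
  show "(\<Sum>p\<le>k. pq_part J k p \<alpha>) c x v = \<alpha> c x v"
  proof (cases "c \<in> A \<and> x \<in> chart_image c")
    case True
    then have c: "c \<in> A" "x \<in> chart_image c" by simp_all
    show ?thesis
      unfolding sum_form_apply pq_part_def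
      by (rule sum_pq_projection[OF B endo_field_linear[OF acm_endo_field c]
            acm_square[OF c] forms_alternating[OF \<alpha> c]])
  next
    case False
    then show ?thesis
      by (simp add: sum_form_apply pq_part_def pq_projection_def forms_outside[OF \<alpha> False])
  qed
qed

text \<open>The components are grouped by the parity of \<open>p\<close>; that each is a smooth form
  is what \<open>sum_pq_forms\<close> requires.\<close>

lemma ev_od_decomposition:
  assumes \<alpha>: "\<alpha> \<in> forms A k"
  shows "\<exists>\<beta>\<in>ev_forms A J k. \<exists>\<gamma>\<in>od_forms A J k. \<alpha> = \<beta> + \<gamma>"
proof -
  have part: "(\<Sum>p | p \<le> k \<and> P p. pq_part J k p \<alpha>) \<in> sum_pq_forms A J P k" for P
    unfolding sum_pq_forms_def using pq_part_pq_forms[OF \<alpha>] by blast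
  have "{..k} = {p. p \<le> k \<and> even p} \<union> {p. p \<le> k \<and> odd p}" by auto
  then have "\<alpha> = (\<Sum>p\<in>{p. p \<le> k \<and> even p} \<union> {p. p \<le> k \<and> odd p}. pq_part J k p \<alpha>)"
    using sum_pq_part[OF \<alpha>] by simp
  also have "\<dots> = (\<Sum>p | p \<le> k \<and> even p. pq_part J k p \<alpha>) + (\<Sum>p | p \<le> k \<and> odd p. pq_part J k p \<alpha>)"
    by (rule sum.union_disjoint) auto
  finally show ?thesis using part[of even] part[of odd] by blast
qed

text \<open>\<open>J\<close> is the rotation by \<open>pi / 2\<close>, so this is the weight formula
  at that angle.\<close>

lemma J_form_pq_forms:
  assumes \<beta>: "\<beta> \<in> pq_forms A J p q"
  shows "J_form J \<beta> = scale_form (cis (pi / 2 * (real p - real q))) \<beta>"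
proof (intro ext)
  fix c x v
  have f: "\<beta> \<in> forms A (p + q)" using \<beta> by (simp add: pq_forms_def)
  show "J_form J \<beta> c x v = scale_form (cis (pi / 2 * (real p - real q))) \<beta> c x v"
  proof (cases "c \<in> A \<and> x \<in> chart_image c")
    case True
    then have "\<beta> c x \<in> pq_covectors p q (J c x)" using \<beta> by (simp add: pq_forms_def)
    from pq_covectors_rotate[OF this, of "pi / 2" v] show ?thesis
      by (simp add: cplx_rotate_def J_form_def scale_form_def)
  next
    case False
    then show ?thesis by (simp add: forms_outside[OF f] J_form_def scale_form_def)
  qed
qed

text \<open>\<open>s\<close> is the common value of (-1)^p on the summands, 1 for
  \<open>even\<close> and -1 for \<open>odd\<close>; the other factor depends only on the total
  degree.\<close>

lemma J_form_sum_pq_forms: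
  assumes \<beta>: "\<beta> \<in> sum_pq_forms A J P k" and s: "\<And>p. P p \<Longrightarrow> (- 1) ^ p = s"
  shows "J_form J \<beta> = scale_form (s * cis (- (pi / 2 * real k))) \<beta>"
proof -
  obtain b where b: "\<beta> = (\<Sum>p | p \<le> k \<and> P p. b p)" "\<And>p. p \<le> k \<Longrightarrow> P p \<Longrightarrow> b p \<in> pq_forms A J p (k - p)"
    using \<beta> unfolding sum_pq_forms_def by blast
  have "cis (pi / 2 * (real p - real (k - p))) = s * cis (- (pi / 2 * real k))" if "p \<le> k" "P p" for p
  proof -
    have "cis (pi / 2 * (real p - real (k - p))) = cis (real p * pi) * cis (- (pi / 2 * real k))"
      unfolding cis_mult using that by (intro arg_cong[of _ _ cis]) (simp add: of_nat_diff field_simps)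
    then show ?thesis using s[OF that(2)] by (simp flip: Complex.DeMoivre)
  qed
  then have eq: "J_form J (b p) = scale_form (s * cis (- (pi / 2 * real k))) (b p)" if "p \<le> k" "P p" for p
    using J_form_pq_forms[OF b(2)[OF that]] that by simp
  have "J_form J \<beta> c x v = scale_form (s * cis (- (pi / 2 * real k))) \<beta> c x v" for c x v
  proof -
    have "J_form J \<beta> c x v = (\<Sum>p | p \<le> k \<and> P p. J_form J (b p) c x v)"
      by (simp only: b(1) J_form_def sum_form_apply)
    also have "\<dots> = (\<Sum>p | p \<le> k \<and> P p. scale_form (s * cis (- (pi / 2 * real k))) (b p) c x v)"
      by (intro sum.cong refl) (simp add: eq)
    also have "\<dots> = scale_form (s * cis (- (pi / 2 * real k))) \<beta> c x v"
      by (simp only: b(1) scale_form_def sum_form_apply sum_distrib_left)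
    finally show ?thesis .
  qed
  then show ?thesis by (intro ext)
qed

text \<open>Solves \<beta> + \<gamma> = \<alpha> and \<beta> - \<gamma> = i^k J\<alpha>. The
  right-hand sides depend only on the sum, which is the uniqueness behind the descriptions
  \<open>ev_part\<close> and \<open>od_part\<close>.\<close>

lemma ev_od_summands:
  assumes \<beta>: "\<beta> \<in> ev_forms A J k" and \<gamma>: "\<gamma> \<in> od_forms A J k"
  shows "\<beta> = scale_form (1 / 2) ((\<beta> + \<gamma>) + scale_form (cis (pi / 2 * real k)) (J_form J (\<beta> + \<gamma>)))"
    and "\<gamma> = scale_form (1 / 2) ((\<beta> + \<gamma>) + scale_form (- cis (pi / 2 * real k)) (J_form J (\<beta> + \<gamma>)))"
proof -
  define e e' where "e = cis (pi / 2 * real k)" and "e' = cis (- (pi / 2 * real k))"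
  have J\<beta>: "J_form J \<beta> = scale_form (1 * e') \<beta>"
    unfolding e'_def by (rule J_form_sum_pq_forms[OF \<beta>]) simp
  have J\<gamma>: "J_form J \<gamma> = scale_form (- 1 * e') \<gamma>"
    unfolding e'_def by (rule J_form_sum_pq_forms[OF \<gamma>]) simp
  have "e * e' = 1" by (simp add: e_def e'_def cis_mult)
  then have *: "e * (1 * e' * x + - 1 * e' * y) = x - y" "- e * (1 * e' * x + - 1 * e' * y) = y - x" for x y
    by algebra+
  show "\<beta> = scale_form (1 / 2) ((\<beta> + \<gamma>) + scale_form (cis (pi / 2 * real k)) (J_form J (\<beta> + \<gamma>)))"
    "\<gamma> = scale_form (1 / 2) ((\<beta> + \<gamma>) + scale_form (- cis (pi / 2 * real k)) (J_form J (\<beta> + \<gamma>)))"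
    unfolding J_form_add J\<beta> J\<gamma> e_def[symmetric]
    by (intro ext, simp only: scale_form_def plus_fun_apply *, simp)+
qed

lemma
  assumes \<alpha>: "\<alpha> \<in> forms A k"
  shows ev_part_ev_forms: "ev_part A J k \<alpha> \<in> ev_forms A J k"
    and od_part_od_forms: "od_part A J k \<alpha> \<in> od_forms A J k"
    and ev_part_plus_od_part: "ev_part A J k \<alpha> + od_part A J k \<alpha> = \<alpha>"
    and ev_part_eq: "ev_part A J k \<alpha> = scale_form (1 / 2) (\<alpha> + scale_form (cis (pi / 2 * real k)) (J_form J \<alpha>))"
    and od_part_eq: "od_part A J k \<alpha> = scale_form (1 / 2) (\<alpha> + scale_form (- cis (pi / 2 * real k)) (J_form J \<alpha>))"
proof -
  obtain \<beta> \<gamma> where *: "\<beta> \<in> ev_forms A J k" "\<gamma> \<in> od_forms A J k" "\<alpha> = \<beta> + \<gamma>"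
    using ev_od_decomposition[OF \<alpha>] by blast
  have ev: "ev_part A J k \<alpha> = \<beta>"
    unfolding ev_part_def
  proof (rule the_equality)
    fix \<beta>' assume "\<beta>' \<in> ev_forms A J k \<and> (\<exists>\<gamma>\<in>od_forms A J k. \<alpha> = \<beta>' + \<gamma>)"
    then obtain \<gamma>' where "\<beta>' \<in> ev_forms A J k" "\<gamma>' \<in> od_forms A J k" "\<alpha> = \<beta>' + \<gamma>'" by blast
    from ev_od_summands(1)[OF this(1,2), folded this(3)] show "\<beta>' = \<beta>"
      using ev_od_summands(1)[OF *(1,2), folded *(3)] by (rule trans[OF _ sym])
  qed (use * in blast)
  have od: "od_part A J k \<alpha> = \<gamma>"
    unfolding od_part_def
  proof (rule the_equality)
    fix \<gamma>' assume "\<gamma>' \<in> od_forms A J k \<and> (\<exists>\<beta>\<in>ev_forms A J k. \<alpha> = \<beta> + \<gamma>')"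
    then obtain \<beta>' where "\<beta>' \<in> ev_forms A J k" "\<gamma>' \<in> od_forms A J k" "\<alpha> = \<beta>' + \<gamma>'" by blast
    from ev_od_summands(2)[OF this(1,2), folded this(3)] show "\<gamma>' = \<gamma>"
      using ev_od_summands(2)[OF *(1,2), folded *(3)] by (rule trans[OF _ sym])
  qed (use * in blast)
  show "ev_part A J k \<alpha> \<in> ev_forms A J k" unfolding ev by (rule *(1))
  show "od_part A J k \<alpha> \<in> od_forms A J k" unfolding od by (rule *(2))
  show "ev_part A J k \<alpha> + od_part A J k \<alpha> = \<alpha>" unfolding ev od by (rule *(3)[symmetric])
  show "ev_part A J k \<alpha> = scale_form (1 / 2) (\<alpha> + scale_form (cis (pi / 2 * real k)) (J_form J \<alpha>))"
    unfolding ev by (rule ev_od_summands(1)[OF *(1,2), folded *(3)])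
  show "od_part A J k \<alpha> = scale_form (1 / 2) (\<alpha> + scale_form (- cis (pi / 2 * real k)) (J_form J \<alpha>))"
    unfolding od by (rule ev_od_summands(2)[OF *(1,2), folded *(3)])
qed

section \<open>Closed parts and their classes\<close>

lemma
  assumes "\<alpha> \<in> BC_closed A J k"
  shows ev_part_closed: "ev_part A J k \<alpha> \<in> dR_closed A k"
    and od_part_closed: "od_part A J k \<alpha> \<in> dR_closed A k"
proof -
  have \<alpha>: "\<alpha> \<in> forms A k" "ext_d A k \<alpha> = 0" "ext_dc A J k \<alpha> = 0"
    using assms by (auto simp: BC_closed_def B_forms_def)
  have J\<alpha>: "J_form J \<alpha> \<in> forms A k" "ext_d A k (J_form J \<alpha>) = 0"
    using \<alpha> ext_dc_eq_0_iff by (auto intro: acm_J_form_forms acm_endo_field)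
  have "scale_form (1 / 2) (\<alpha> + scale_form z (J_form J \<alpha>)) \<in> dR_closed A k" for z
    using \<alpha>(1,2) J\<alpha> by (simp add: dR_closed_def acm_forms_scale acm_forms_add acm_ext_d_scale acm_ext_d_add)
  then show "ev_part A J k \<alpha> \<in> dR_closed A k" "od_part A J k \<alpha> \<in> dR_closed A k"
    unfolding ev_part_eq[OF \<alpha>(1)] od_part_eq[OF \<alpha>(1)] by blast+
qed

lemma
  assumes "\<alpha> \<in> BC_closed A J k"
  shows dR_class_ev_part: "dR_class A k (ev_part A J k \<alpha>) \<in> H_ev A J k"
    and dR_class_od_part: "dR_class A k (od_part A J k \<alpha>) \<in> H_od A J k"
    and dR_class_ev_part_plus_od_part:
      "dR_class A k (ev_part A J k \<alpha>) + dR_class A k (od_part A J k \<alpha>) = dR_class A k \<alpha>"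
proof -
  have \<alpha>: "\<alpha> \<in> forms A k" using assms by (simp add: BC_closed_def B_forms_def)
  show "dR_class A k (ev_part A J k \<alpha>) \<in> H_ev A J k"
    unfolding H_ev_def dR_cohomology_def
    using ev_part_closed[OF assms] ev_part_ev_forms[OF \<alpha>] by blast
  show "dR_class A k (od_part A J k \<alpha>) \<in> H_od A J k"
    unfolding H_od_def dR_cohomology_def
    using od_part_closed[OF assms] od_part_od_forms[OF \<alpha>] by blast
  show "dR_class A k (ev_part A J k \<alpha>) + dR_class A k (od_part A J k \<alpha>) = dR_class A k \<alpha>"
    unfolding dR_class_def coset_plus_coset[OF form_subspace_dR_exact] ev_part_plus_od_part[OF \<alpha>] ..
qed

text \<open>The source of well-definedness: the de Rham class is computed from the Bott-Chern coset
  as a set, without choosing a representative.\<close>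

lemma BC_class_plus_dR_exact: "BC_class A J k \<alpha> + dR_exact A k = dR_class A k \<alpha>"
  unfolding BC_class_def dR_class_def
  using form_subspace_BC_exact
  by (intro coset_plus_subspace form_subspace_dR_exact BC_exact_subset_dR_exact)
     (simp add: form_subspace_def)

lemma BC_class_add: "BC_class A J k \<alpha> + BC_class A J k \<beta> = BC_class A J k (\<alpha> + \<beta>)"
  unfolding BC_class_def by (rule coset_plus_coset[OF form_subspace_BC_exact])

lemma BC_class_scale: "scale_coset (BC_exact A J k) z (BC_class A J k \<alpha>) = BC_class A J k (scale_form z \<alpha>)"
  unfolding BC_class_def by (rule scale_coset_coset[OF form_subspace_BC_exact])

lemma dR_class_add: "dR_class A k \<alpha> + dR_class A k \<beta> = dR_class A k (\<alpha> + \<beta>)"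
  unfolding dR_class_def by (rule coset_plus_coset[OF form_subspace_dR_exact])

lemma dR_class_scale: "scale_coset (dR_exact A k) z (dR_class A k \<alpha>) = dR_class A k (scale_form z \<alpha>)"
  unfolding dR_class_def by (rule scale_coset_coset[OF form_subspace_dR_exact])

end

theorem theorem3p20:
  fixes X :: "'a topology" and A :: "('a, 'e::real_inner) chart set"
    and J :: "('a, 'e) endo_field" and m k :: nat
  assumes "almost_complex_manifold m X A J"
  shows "\<exists>!\<Phi>. \<Phi> \<in> BC_cohomology A J k \<rightarrow>\<^sub>E H_ev A J k + H_od A J k \<and>
    (\<forall>\<alpha>\<in>BC_closed A J k.
       dR_class A k (ev_part A J k \<alpha>) \<in> H_ev A J k \<and>
       dR_class A k (od_part A J k \<alpha>) \<in> H_od A J k \<and>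
       \<Phi> (BC_class A J k \<alpha>) =
         dR_class A k (ev_part A J k \<alpha>) + dR_class A k (od_part A J k \<alpha>)) \<and>
    (\<forall>C\<in>BC_cohomology A J k. \<forall>D\<in>BC_cohomology A J k. \<Phi> (C + D) = \<Phi> C + \<Phi> D) \<and>
    (\<forall>z. \<forall>C\<in>BC_cohomology A J k.
       \<Phi> (scale_coset (BC_exact A J k) z C) = scale_coset (dR_exact A k) z (\<Phi> C))"
proof (rule ex1I)
  \<comment> \<open>\<open>restrict\<close> fixes the values outside \<open>BC_cohomology\<close>,
    as the extensional function space requires.\<close>
  define \<Phi> where "\<Phi> = restrict (\<lambda>C. C + dR_exact A k) (BC_cohomology A J k)"
  have \<Phi>: "\<Phi> (BC_class A J k \<alpha>) = dR_class A k \<alpha>" if "\<alpha> \<in> BC_closed A J k" for \<alpha>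
    using that by (simp add: \<Phi>_def BC_cohomology_def BC_class_plus_dR_exact[OF assms])
  have closed: "\<alpha> + \<beta> \<in> BC_closed A J k" "scale_form z \<alpha> \<in> BC_closed A J k"
    if "\<alpha> \<in> BC_closed A J k" "\<beta> \<in> BC_closed A J k" for \<alpha> \<beta> z
    using that form_subspace_BC_closed[OF assms, of k] by (simp_all add: form_subspace_def)
  note parts = dR_class_ev_part[OF assms] dR_class_od_part[OF assms] dR_class_ev_part_plus_od_part[OF assms]
  have "\<Phi> \<in> BC_cohomology A J k \<rightarrow>\<^sub>E H_ev A J k + H_od A J k"
  proof (rule PiE_I)
    fix C assume "C \<in> BC_cohomology A J k"
    then obtain \<alpha> where \<alpha>: "\<alpha> \<in> BC_closed A J k" "C = BC_class A J k \<alpha>"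
      unfolding BC_cohomology_def by blast
    show "\<Phi> C \<in> H_ev A J k + H_od A J k"
      unfolding \<alpha>(2) \<Phi>[OF \<alpha>(1)] parts(3)[OF \<alpha>(1), symmetric]
      by (intro set_plus_intro parts(1,2)[OF \<alpha>(1)])
  qed (simp add: \<Phi>_def)
  moreover have "\<Phi> (C + D) = \<Phi> C + \<Phi> D" if CD: "C \<in> BC_cohomology A J k" "D \<in> BC_cohomology A J k" for C D
  proof -
    obtain \<alpha> \<beta> where "\<alpha> \<in> BC_closed A J k" "C = BC_class A J k \<alpha>"
      "\<beta> \<in> BC_closed A J k" "D = BC_class A J k \<beta>"
      using CD unfolding BC_cohomology_def by blast
    then show ?thesis by (simp add: \<Phi> closed BC_class_add[OF assms] dR_class_add[OF assms])
  qed
  moreover have "\<Phi> (scale_coset (BC_exact A J k) z C) = scale_coset (dR_exact A k) z (\<Phi> C)"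
    if C: "C \<in> BC_cohomology A J k" for z C
  proof -
    obtain \<alpha> where "\<alpha> \<in> BC_closed A J k" "C = BC_class A J k \<alpha>"
      using C unfolding BC_cohomology_def by blast
    then show ?thesis by (simp add: \<Phi> closed BC_class_scale[OF assms] dR_class_scale[OF assms])
  qed
  ultimately show "\<Phi> \<in> BC_cohomology A J k \<rightarrow>\<^sub>E H_ev A J k + H_od A J k \<and>
    (\<forall>\<alpha>\<in>BC_closed A J k.
       dR_class A k (ev_part A J k \<alpha>) \<in> H_ev A J k \<and>
       dR_class A k (od_part A J k \<alpha>) \<in> H_od A J k \<and>
       \<Phi> (BC_class A J k \<alpha>) =
         dR_class A k (ev_part A J k \<alpha>) + dR_class A k (od_part A J k \<alpha>)) \<and>
    (\<forall>C\<in>BC_cohomology A J k. \<forall>D\<in>BC_cohomology A J k. \<Phi> (C + D) = \<Phi> C + \<Phi> D) \<and>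
    (\<forall>z. \<forall>C\<in>BC_cohomology A J k.
       \<Phi> (scale_coset (BC_exact A J k) z C) = scale_coset (dR_exact A k) z (\<Phi> C))"
    using parts by (simp add: \<Phi>)
  fix \<Psi> assume \<Psi>: "\<Psi> \<in> BC_cohomology A J k \<rightarrow>\<^sub>E H_ev A J k + H_od A J k \<and>
    (\<forall>\<alpha>\<in>BC_closed A J k.
       dR_class A k (ev_part A J k \<alpha>) \<in> H_ev A J k \<and>
       dR_class A k (od_part A J k \<alpha>) \<in> H_od A J k \<and>
       \<Psi> (BC_class A J k \<alpha>) =
         dR_class A k (ev_part A J k \<alpha>) + dR_class A k (od_part A J k \<alpha>)) \<and>
    (\<forall>C\<in>BC_cohomology A J k. \<forall>D\<in>BC_cohomology A J k. \<Psi> (C + D) = \<Psi> C + \<Psi> D) \<and>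
    (\<forall>z. \<forall>C\<in>BC_cohomology A J k.
       \<Psi> (scale_coset (BC_exact A J k) z C) = scale_coset (dR_exact A k) z (\<Psi> C))"
  \<comment> \<open>Every Bott-Chern class has a representative in \<open>BC_closed\<close>, and
    there the prescribed formula determines the value.\<close>
  show "\<Psi> = \<Phi>"
  proof (rule extensionalityI[of _ "BC_cohomology A J k"])
    show "\<Psi> \<in> extensional (BC_cohomology A J k)" using \<Psi> by (simp add: PiE_iff)
    show "\<Phi> \<in> extensional (BC_cohomology A J k)" by (simp add: \<Phi>_def)
    fix C assume "C \<in> BC_cohomology A J k"
    then obtain \<alpha> where \<alpha>: "\<alpha> \<in> BC_closed A J k" "C = BC_class A J k \<alpha>"
      unfolding BC_cohomology_def by blast
    then have "\<Psi> C = dR_class A k (ev_part A J k \<alpha>) + dR_class A k (od_part A J k \<alpha>)"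
      using \<Psi> by blast
    then show "\<Psi> C = \<Phi> C" using \<alpha> by (simp add: \<Phi> parts(3))
  qed
qed

end
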